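(* Let $X\in\mathbb{R}^{n\times d}$ with $n>d$, let $y\in\mathbb{R}^n$, let $\epsilon>0$ be an error parameter, and let $$\beta_{\mathrm{lsr}}=\operatorname{argmin}_{\beta\in\mathbb{R}^d}\|y-X\beta\|_2^2 .$$ Use the leverage score based sampling without replacement (the algorithm given in the context), applied to $X$ with target dimension $c$, to construct the sampling matrix $S$ (nominally of size $c\times n$), where $$c\;\ge\;\mathcal{O}\big(d\ln d+d\,\epsilon^{-1}\big),$$ and solve the approximate least squares problem $$\tilde\beta_S=\operatorname{argmin}_{\beta\in\mathbb{R}^d}\|Sy-SX\beta\|_2^2 .$$ Then with probability at least $0.8$ the following inequalities hold: $$\|y-X\tilde\beta_S\|_2^2\;\le\;(1+\epsilon)\,\|y-X\beta_{\mathrm{lsr}}\|_2^2,$$ $$\|\beta_{\mathrm{lsr}}-\tilde\beta_S\|_2^2\;\le\;\frac{\epsilon}{\sigma_{\min}^2(X)}\,\|y-X\beta_{\mathrm{lsr}}\|_2^2\;\le\;\epsilon\,\kappa^2(X)\,\big(\gamma^{-2}-1\big)\,\|\beta_{\mathrm{lsr}}\|_2^2 ,$$ where $\gamma>0$ is defined by $\gamma\le\|U_XU_X^Ty\|_2/\|y\|_2\le 1$.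
   Context: The thin singular value decomposition of $X\in\mathbb{R}^{n\times d}$ is $X=U_X\Sigma_XV_X^T$, with $U_X$, $\Sigma_X$, $V_X$ of sizes $n\times d$, $d\times d$, $d\times d$. $\sigma_{\max}(X)$ and $\sigma_{\min}(X)$ are the largest and smallest (the $d$-th) singular values of $X$, with $\sigma_{\min}(X)>0$, and $\kappa(X)=\sigma_{\max}(X)/\sigma_{\min}(X)$ is the condition number. The (row) statistical leverage scores of $X$ are $l_i=\|u_X^{(i)}\|_2^2$, $i=1,\dots,n$, where $u_X^{(i)}$ is the $i$-th row of $U_X$; they satisfy $\sum_{i=1}^n l_i=d$. Leverage score based sampling (without replacement). Input: a real $n\times d$ matrix $X$ and a target dimension $c<n$. (1) Exactly or approximately compute the leverage scores $l_1,\dots,l_n$ of $X$. (2) Compute the sampling probabilities $p_i=\min\{1,\,c\,l_i/d\}$ for $i=1,\dots,n$. (3) Start with the index set $\mathcal{C}=\emptyset$ and, for each index $i\in\{1,\dots,n\}$, add $i$ to $\mathcal{C}$ with probability $p_i$. (4) Compute the diagonal matrix $D=\operatorname{diag}(p_1^{-1},\dots,p_n^{-1})$. (5) Return $S$, the matrix formed by the rows of $D$ indexed by $\mathcal{C}$. The paper describes $S$ as having $c$ rows in expectation. The probability in the claim is over this random sampling. The condition $c\ge\mathcal{O}(\cdot)$ means that $c$ is at least a sufficiently large absolute constant times the quantity in parentheses.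
   Formalization: S is formed from rows of the square root of D (entries p_i^{-1/2}) rather than of D, and c is also required to exceed an absolute constant (matters only for d=1, ε>1); both literal versions are false. Leverage scores are exact. *)

theory Defs
  imports
    "HOL-Probability.Product_PMF"
    "Jordan_Normal_Form.DL_Submatrix"
begin

text \<open>
  Matrices and vectors are those of \<^theory>\<open>Jordan_Normal_Form.Matrix\<close>, with dimensions given by
  natural numbers, because the constant hidden in the lower bound on the target dimension has
  to be chosen before the dimensions are. Indices run from \<open>0\<close>.
\<close>

definition l2_norm :: "real vec \<Rightarrow> real" where
  "l2_norm v = sqrt (v \<bullet> v)"

text \<open>The singular values are the diagonal entries of \<open>\<Sigma>\<close>; they need not be sorted.\<close>

definition thin_svd :: "real mat \<Rightarrow> real mat \<Rightarrow> real mat \<Rightarrow> real mat \<Rightarrow> bool" where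
  "thin_svd X U \<Sigma> V \<longleftrightarrow>
     U \<in> carrier_mat (dim_row X) (dim_col X) \<and>
     \<Sigma> \<in> carrier_mat (dim_col X) (dim_col X) \<and>
     V \<in> carrier_mat (dim_col X) (dim_col X) \<and>
     U\<^sup>T * U = 1\<^sub>m (dim_col X) \<and>
     V\<^sup>T * V = 1\<^sub>m (dim_col X) \<and>
     diagonal_mat \<Sigma> \<and> (\<forall>i < dim_col X. 0 \<le> \<Sigma> $$ (i, i)) \<and>
     X = U * \<Sigma> * V\<^sup>T"

definition sigma_max :: "real mat \<Rightarrow> real" where
  "sigma_max \<Sigma> = Max (set (diag_mat \<Sigma>))"

definition sigma_min :: "real mat \<Rightarrow> real" where
  "sigma_min \<Sigma> = Min (set (diag_mat \<Sigma>))"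

definition cond_number :: "real mat \<Rightarrow> real" where
  "cond_number \<Sigma> = sigma_max \<Sigma> / sigma_min \<Sigma>"

definition leverage_score :: "real mat \<Rightarrow> nat \<Rightarrow> real" where
  "leverage_score U i = (l2_norm (row U i))\<^sup>2"

definition sampling_prob :: "real mat \<Rightarrow> nat \<Rightarrow> nat \<Rightarrow> real" where
  "sampling_prob U c i = min 1 (real c * leverage_score U i / real (dim_col U))"

text \<open>
  Every index is included independently of the others. \<open>Pi_pmf\<close> takes a default value for the
  indices outside the given finite set.
\<close>

definition sampled_indices :: "real mat \<Rightarrow> nat \<Rightarrow> nat set pmf" where
  "sampled_indices U c =
     map_pmf (\<lambda>\<omega>. {i. i < dim_row U \<and> \<omega> i})
       (Pi_pmf {..<dim_row U} False (\<lambda>i. bernoulli_pmf (sampling_prob U c i)))"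

text \<open>
  An index of probability \<open>0\<close> gets the entry \<open>1 / 0 = 0\<close>; almost surely it is not sampled.
\<close>

definition rescaling_mat :: "real mat \<Rightarrow> nat \<Rightarrow> real mat" where
  "rescaling_mat U c = mat_diag (dim_row U) (\<lambda>i. 1 / sampling_prob U c i)"

text \<open>
  The rows are taken from the square root of the diagonal matrix \<open>D = rescaling_mat U c\<close>. Then a
  sampled residual enters \<open>\<parallel>S y - S X \<beta>\<parallel>\<^sup>2\<close> with weight \<open>1 / p\<^sub>i\<close>, so that the
  sketched objective is an unbiased estimate of the original one (if no \<open>p\<^sub>i\<close> is \<open>0\<close>). Rows of
  \<open>D\<close> itself give the weights \<open>1 / p\<^sub>i\<^sup>2\<close>, and the sketched minimizer then
  approximates that of a differently weighted problem.
\<close>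

definition sampling_mat :: "real mat \<Rightarrow> nat \<Rightarrow> nat set \<Rightarrow> real mat" where
  "sampling_mat U c C = submatrix (map_mat sqrt (rescaling_mat U c)) C UNIV"

definition lsq_solution :: "real mat \<Rightarrow> real vec \<Rightarrow> real vec \<Rightarrow> bool" where
  "lsq_solution A b \<beta> \<longleftrightarrow>
     is_arg_min (\<lambda>\<beta>. (l2_norm (b - A *\<^sub>v \<beta>))\<^sup>2) (\<lambda>\<beta>. \<beta> \<in> carrier_vec (dim_col A)) \<beta>"

end

theory Submission
  imports Defs "Jordan_Normal_Form.Determinant"
begin

text \<open>
  Let \<open>u\<^sub>i\<close> be the rows of \<open>U\<close>, \<open>h = d / c\<close>, and
  \<open>M = \<Sum>\<^sub>i (b\<^sub>i / p\<^sub>i - 1) u\<^sub>i u\<^sub>i\<^sup>T\<close> the deviation of the sampled Gram matrix from the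
  identity, where the \<open>b\<^sub>i\<close> are the independent Bernoulli variables. Two events suffice: \<open>M\<close> has
  no eigenvalue below \<open>-1/2\<close>, and the sampled cross term between \<open>U\<close> and the optimal residual is
  small. The second follows from a variance computation and Markov's inequality.

  The first needs the \<open>d ln d\<close> samples. Instead of a matrix Chernoff bound, the moments
  \<open>T\<^sub>q = E tr M\<^sup>q\<close> are bounded recursively by an exchangeable-pairs argument. Resampling one \<open>b\<^sub>i\<close> is
  a rank-one update of \<open>M\<close>, so \<open>T\<^sub>2\<^sub>r\<^sub>+\<^sub>2\<close> telescopes into products of moments
  \<open>u\<^sub>i\<^sup>T A\<^sup>q u\<^sub>i \<cdot> u\<^sub>i\<^sup>T B\<^sup>2\<^sup>r\<^sup>-\<^sup>q u\<^sub>i\<close>, and log-convexity of moment sequences moves all powers to one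
  factor. This gives \<open>T\<^sub>2\<^sub>r\<^sub>+\<^sub>2 \<le> (2r + 1) h (T\<^sub>2\<^sub>r\<^sub>+\<^sub>1 + 2 T\<^sub>2\<^sub>r)\<close>, hence \<open>T\<^sub>2\<^sub>P \<le> d (10 P h)\<^sup>P\<close>, and
  \<open>P \<approx> ln d\<close> absorbs the factor \<open>d\<close>.
\<close>

section \<open>Moments of self-adjoint operators\<close>

text \<open>
  Vectors are functions on \<open>nat\<close> of which only the first \<open>d\<close> values matter; this keeps all
  statements about \<open>ip\<close> free of carrier conditions.
\<close>

definition ip :: "nat \<Rightarrow> (nat \<Rightarrow> real) \<Rightarrow> (nat \<Rightarrow> real) \<Rightarrow> real" where
  "ip d x y = (\<Sum>k<d. x k * y k)"

lemma ip_commute: "ip d x y = ip d y x"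
  by (simp add: ip_def mult.commute)

lemma ip_nonneg: "0 \<le> ip d x x"
  by (simp add: ip_def sum_nonneg)

lemma ip_Cauchy_Schwarz: "(ip d x y)\<^sup>2 \<le> ip d x x * ip d y y"
  using Cauchy_Schwarz_ineq_sum[of x y "{..<d}"] by (simp add: ip_def power2_eq_square)

lemma ip_two_mult_le: "2 * ip d x y \<le> ip d x x + ip d y y"
proof -
  have "2 * (x k * y k) \<le> x k * x k + y k * y k" for k
    using sum_squares_bound[of "x k" "y k"] by (simp add: power2_eq_square)
  then show ?thesis
    by (simp add: ip_def sum_distrib_left flip: sum.distrib) (rule sum_mono, simp)
qed

lemma ip_sum_right: "ip d x (\<lambda>k. \<Sum>i\<in>I. w i * v i k) = (\<Sum>i\<in>I. w i * ip d x (v i))"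
  unfolding ip_def
  by (simp add: sum_distrib_left sum.swap[of _ "{..<d}"] mult.left_commute)

text \<open>If the maximum exceeded both endpoint values, its leftmost position would be interior
  with a strictly smaller left neighbour, against log-convexity there. The multiplicative form
  avoids logarithms and admits zeros.\<close>

lemma logconvex_le_endpoints:
  fixes g :: "nat \<Rightarrow> real"
  assumes nonneg: "\<And>k. k \<le> r \<Longrightarrow> 0 \<le> g k"
    and logconvex: "\<And>k. 0 < k \<Longrightarrow> k < r \<Longrightarrow> (g k)\<^sup>2 \<le> g (k - 1) * g (k + 1)"
    and "k \<le> r"
  shows "g k \<le> max (g 0) (g r)"
proof (rule ccontr)
  assume contra: "\<not> ?thesis"
  define m where "m = Max (g ` {..r})"
  have le_m: "g j \<le> m" if "j \<le> r" for j
    unfolding m_def using that by (intro Max_ge) auto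
  have "m \<in> g ` {..r}"
    unfolding m_def by (rule Max_in) auto
  then have ex: "\<exists>j. j \<le> r \<and> g j = m" by auto
  define j where "j = (LEAST j. j \<le> r \<and> g j = m)"
  have j: "j \<le> r" "g j = m"
    using LeastI_ex[OF ex] by (auto simp: j_def)
  have m_gt: "m > max (g 0) (g r)"
    using contra le_m[OF \<open>k \<le> r\<close>] by linarith
  then have "0 < j" "j < r"
    using j by (metis max.strict_boundedE less_irrefl not_gr_zero,
      metis j max.strict_boundedE less_irrefl nat_less_le)
  have "g (j - 1) \<noteq> m"
    using not_less_Least[of "j - 1" "\<lambda>j. j \<le> r \<and> g j = m"] \<open>0 < j\<close> \<open>j < r\<close>
    by (auto simp: j_def)
  then have lt: "g (j - 1) < m"
    using le_m[of "j - 1"] \<open>j < r\<close> by force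
  have "0 < m"
    using m_gt nonneg[of 0] by simp
  have "m * m \<le> g (j - 1) * g (j + 1)"
    using logconvex[OF \<open>0 < j\<close> \<open>j < r\<close>] j by (simp add: power2_eq_square)
  also have "\<dots> \<le> g (j - 1) * m"
    using le_m[of "j + 1"] nonneg[of "j - 1"] \<open>j < r\<close> by (intro mult_left_mono) auto
  also have "\<dots> < m * m"
    using lt \<open>0 < m\<close> by simp
  finally show False by simp
qed

text \<open>The identity already forces \<open>A\<close> to be linear, up to coordinates from
  \<open>d\<close> on.\<close>

definition self_adjoint :: "nat \<Rightarrow> ((nat \<Rightarrow> real) \<Rightarrow> nat \<Rightarrow> real) \<Rightarrow> bool" where
  "self_adjoint d A \<longleftrightarrow> (\<forall>x y. ip d (A x) y = ip d x (A y))"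

text \<open>These are the moments of the spectral measure of \<open>A\<close> at \<open>x\<close>;
  working with them replaces diagonalization.\<close>

definition moment ::
  "nat \<Rightarrow> ((nat \<Rightarrow> real) \<Rightarrow> nat \<Rightarrow> real) \<Rightarrow> (nat \<Rightarrow> real) \<Rightarrow> nat \<Rightarrow> real" where
  "moment d A x q = ip d x ((A ^^ q) x)"

lemma self_adjoint_funpow:
  assumes "self_adjoint d A"
  shows "ip d ((A ^^ i) x) y = ip d x ((A ^^ i) y)"
proof (induction i arbitrary: y)
  case (Suc i)
  have "ip d ((A ^^ Suc i) x) y = ip d ((A ^^ i) x) (A y)"
    using assms by (simp add: self_adjoint_def)
  then show ?case
    by (simp add: Suc funpow_swap1)
qed simp

lemma ip_funpow_funpow:
  assumes "self_adjoint d A"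
  shows "ip d ((A ^^ i) x) ((A ^^ j) x) = moment d A x (i + j)"
  by (simp add: self_adjoint_funpow[OF assms] moment_def funpow_add)

lemma moment_even_nonneg:
  assumes "self_adjoint d A"
  shows "0 \<le> moment d A x (2 * i)"
  using ip_nonneg[of d "(A ^^ i) x"] by (simp add: ip_funpow_funpow[OF assms] mult_2)

lemma moment_Cauchy_Schwarz:
  assumes "self_adjoint d A"
  shows "(moment d A x (i + j))\<^sup>2 \<le> moment d A x (2 * i) * moment d A x (2 * j)"
  using ip_Cauchy_Schwarz[of d "(A ^^ i) x" "(A ^^ j) x"]
  by (simp add: ip_funpow_funpow[OF assms] mult_2)

text \<open>Odd moments may have either sign; this trades one for its even neighbours.\<close>

lemma moment_odd_le:
  assumes "self_adjoint d A"
  shows "2 * moment d A x (2 * r + 1) \<le> moment d A x (2 * r + 2) + moment d A x (2 * r)"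
proof -
  have "moment d A x (2 * r + 1) = ip d ((A ^^ (r + 1)) x) ((A ^^ r) x)"
    "moment d A x (2 * r + 2) = ip d ((A ^^ (r + 1)) x) ((A ^^ (r + 1)) x)"
    "moment d A x (2 * r) = ip d ((A ^^ r) x) ((A ^^ r) x)"
    by (simp_all only: ip_funpow_funpow[OF assms]) (rule arg_cong[where f = "moment d A x"], simp)+
  then show ?thesis
    using ip_two_mult_le[of d "(A ^^ (r + 1)) x" "(A ^^ r) x"] by (simp only:)
qed

lemma moment_0: "moment d A x 0 = ip d x x"
  by (simp add: moment_def)

text \<open>
  The even-index products \<open>a\<^sub>q b\<^sub>2\<^sub>r\<^sub>-\<^sub>q\<close> of the two moment sequences form
  a log-convex sequence, hence are largest at an endpoint; the odd ones are bounded by their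
  neighbours.
\<close>

lemma moment_mult_le:
  assumes A: "self_adjoint d A" and B: "self_adjoint d B" and "q \<le> 2 * r"
  shows "moment d A x q * moment d B x (2 * r - q)
    \<le> ip d x x * (moment d A x (2 * r) + moment d B x (2 * r))"
proof -
  define g where "g k = moment d A x (2 * k) * moment d B x (2 * (r - k))" for k
  have nn: "0 \<le> g k" for k
    unfolding g_def using moment_even_nonneg[OF A] moment_even_nonneg[OF B] by simp
  have lc: "(g k)\<^sup>2 \<le> g (k - 1) * g (k + 1)" if "0 < k" "k < r" for k
  proof -
    have 1: "(moment d A x (2 * k))\<^sup>2 \<le> moment d A x (2 * (k - 1)) * moment d A x (2 * (k + 1))"
      using moment_Cauchy_Schwarz[OF A, of x "k - 1" "k + 1"] that by (simp add: mult_2)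
    have 2: "(moment d B x (2 * (r - k)))\<^sup>2
        \<le> moment d B x (2 * (r - (k - 1))) * moment d B x (2 * (r - (k + 1)))"
    proof -
      have "r - (k - 1) + (r - (k + 1)) = 2 * (r - k)"
        using that by linarith
      then show ?thesis
        using moment_Cauchy_Schwarz[OF B, of x "r - (k - 1)" "r - (k + 1)"] by simp
    qed
    show ?thesis
      using mult_mono[OF 1 2 mult_nonneg_nonneg[OF moment_even_nonneg[OF A] moment_even_nonneg[OF A]]
          zero_le_power2]
      by (simp only: g_def power_mult_distrib mult_ac)
  qed
  define m where "m = ip d x x * (moment d A x (2 * r) + moment d B x (2 * r))"
  have "max (g 0) (g r) \<le> m"
    using mult_nonneg_nonneg[OF ip_nonneg[of d x] moment_even_nonneg[OF A, of x r]]
      mult_nonneg_nonneg[OF ip_nonneg[of d x] moment_even_nonneg[OF B, of x r]]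
    by (auto simp: g_def m_def moment_0 algebra_simps)
  then have m_nonneg: "0 \<le> m"
    using nn[of 0] by simp
  have le_m: "g k \<le> m" if "k \<le> r" for k
    using logconvex_le_endpoints[of r g k] nn lc that \<open>max (g 0) (g r) \<le> m\<close> by force
  have "moment d A x q * moment d B x (2 * r - q) \<le> m"
  proof (cases "even q")
    case True
    then obtain k where "q = 2 * k" by blast
    then show ?thesis
      using le_m[of k] assms(3) by (simp add: g_def right_diff_distrib')
  next
    case False
    then obtain k where q: "q = 2 * k + 1" using oddE by blast
    then have k: "k + 1 \<le> r" using assms(3) by linarith
    have 1: "(moment d A x q)\<^sup>2 \<le> moment d A x (2 * k) * moment d A x (2 * (k + 1))"
      using moment_Cauchy_Schwarz[OF A, of x k "k + 1"] by (simp add: q mult_2)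
    have 2: "(moment d B x (2 * r - q))\<^sup>2
        \<le> moment d B x (2 * (r - k)) * moment d B x (2 * (r - (k + 1)))"
    proof -
      have "(r - k) + (r - (k + 1)) = 2 * r - q"
        using k q by linarith
      then show ?thesis
        using moment_Cauchy_Schwarz[OF B, of x "r - k" "r - (k + 1)"] by simp
    qed
    have "(moment d A x q * moment d B x (2 * r - q))\<^sup>2 \<le> g k * g (k + 1)"
      using mult_mono[OF 1 2 mult_nonneg_nonneg[OF moment_even_nonneg[OF A] moment_even_nonneg[OF A]]
          zero_le_power2]
      by (simp only: g_def power_mult_distrib mult_ac)
    also have "\<dots> \<le> m * m"
      using le_m[of k] le_m[of "k + 1"] nn k m_nonneg by (intro mult_mono) auto
    finally show ?thesis
      by (intro power2_le_imp_le[OF _ m_nonneg]) (simp add: power2_eq_square)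
  qed
  then show ?thesis by (simp add: m_def)
qed

text \<open>The difference of powers telescopes into the terms \<open>A^q (A - B) B^(m-q)\<close>.
  Since \<open>A - B\<close> is \<open>t\<close> times the projection-like map along
  \<open>u\<close>, each term splits into a product of two moments at \<open>u\<close>.\<close>

lemma moment_rank_one_update:
  assumes A: "self_adjoint d A" and B: "self_adjoint d B"
    and update: "\<And>x y. ip d x (A y) = ip d x (B y) + t * ip d u y * ip d u x"
  shows "moment d A u (Suc m) - moment d B u (Suc m)
    = t * (\<Sum>q\<le>m. moment d A u q * moment d B u (m - q))"
proof -
  define f where "f q = ip d u ((A ^^ q) ((B ^^ (Suc m - q)) u))" for q
  have "f (Suc q) - f q = t * (moment d A u q * moment d B u (m - q))" if "q \<le> m" for q
  proof -
    have "f (Suc q) = ip d ((A ^^ q) u) (A ((B ^^ (m - q)) u))"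
      by (simp add: f_def self_adjoint_funpow[OF A] funpow_swap1)
    moreover have "f q = ip d ((A ^^ q) u) (B ((B ^^ (m - q)) u))"
      using that by (simp add: f_def self_adjoint_funpow[OF A] Suc_diff_le)
    ultimately show ?thesis
      by (simp add: update self_adjoint_funpow[OF A] moment_def)
  qed
  then have "(\<Sum>q<Suc m. f (Suc q) - f q) = (\<Sum>q<Suc m. t * (moment d A u q * moment d B u (m - q)))"
    by (intro sum.cong) auto
  then have "f (Suc m) - f 0 = t * (\<Sum>q\<le>m. moment d A u q * moment d B u (m - q))"
    using sum_lessThan_telescope[of f "Suc m"] by (simp only: sum_distrib_left lessThan_Suc_atMost)
  then show ?thesis
    by (simp add: f_def moment_def)
qed

text \<open>With \<open>m = 2 * r\<close> each of the \<open>2 * r + 1\<close> products falls under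
  \<open>moment_mult_le\<close>, so the loss is only linear in \<open>r\<close>.\<close>

lemma moment_rank_one_update_le:
  assumes A: "self_adjoint d A" and B: "self_adjoint d B" and "0 \<le> t"
    and update: "\<And>x y. ip d x (A y) = ip d x (B y) + t * ip d u y * ip d u x"
  shows "moment d A u (2 * r + 1) - moment d B u (2 * r + 1)
    \<le> t * (2 * r + 1) * ip d u u * (moment d A u (2 * r) + moment d B u (2 * r))"
proof -
  have "(\<Sum>q\<le>2*r. moment d A u q * moment d B u (2 * r - q))
      \<le> (\<Sum>q\<le>2*r. ip d u u * (moment d A u (2 * r) + moment d B u (2 * r)))"
    by (intro sum_mono moment_mult_le A B) simp
  from mult_left_mono[OF this \<open>0 \<le> t\<close>]
  have "t * (\<Sum>q\<le>2*r. moment d A u q * moment d B u (2 * r - q))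
      \<le> t * (2 * r + 1) * ip d u u * (moment d A u (2 * r) + moment d B u (2 * r))"
    by (simp add: algebra_simps)
  then show ?thesis
    using moment_rank_one_update[OF A B update, of "2 * r"] by simp
qed

section \<open>Bernoulli sampling of a Parseval frame\<close>

lemma finite_set_Pi_pmf_bool:
  fixes p :: "'a \<Rightarrow> bool pmf"
  assumes "finite A"
  shows "finite (set_pmf (Pi_pmf A dflt p))"
  unfolding set_Pi_pmf[OF assms] by (intro finite_PiE_dflt assms) simp

text \<open>The \<open>u i\<close> play the rows of a matrix with orthonormal columns, which is
  \<open>parseval\<close>. The alternative in \<open>coherence\<close> mirrors the truncation of the
  probabilities at 1: a truncated row may be long, but it carries no randomness.\<close>

locale bernoulli_sampling =
  fixes n d :: nat and u :: "nat \<Rightarrow> nat \<Rightarrow> real" and p :: "nat \<Rightarrow> real" and h :: real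
  assumes p_nonneg: "\<And>i. i < n \<Longrightarrow> 0 \<le> p i"
    and p_le_1: "\<And>i. i < n \<Longrightarrow> p i \<le> 1"
    and h_nonneg: "0 \<le> h"
    and parseval: "\<And>x y. (\<Sum>i<n. ip d (u i) x * ip d (u i) y) = ip d x y"
    and coherence: "\<And>i. i < n \<Longrightarrow> p i = 1 \<or> ip d (u i) (u i) \<le> h * p i"
begin

definition sample :: "(nat \<Rightarrow> bool) pmf" where
  "sample = Pi_pmf {..<n} False (\<lambda>i. bernoulli_pmf (p i))"

abbreviation E :: "((nat \<Rightarrow> bool) \<Rightarrow> real) \<Rightarrow> real" where
  "E \<equiv> measure_pmf.expectation sample"

text \<open>It has mean 1 unless \<open>p i = 0\<close>, where division yields the constant 0; such
  rows vanish by \<open>p_eq_0_imp\<close>.\<close>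

definition weight :: "(nat \<Rightarrow> bool) \<Rightarrow> nat \<Rightarrow> real" where
  "weight \<xi> i = of_bool (\<xi> i) / p i"

text \<open>This is the operator \<open>M\<close> of the overview, acting on functions so that its
  powers are iterates.\<close>

definition gram_dev :: "(nat \<Rightarrow> bool) \<Rightarrow> (nat \<Rightarrow> real) \<Rightarrow> nat \<Rightarrow> real" where
  "gram_dev \<xi> x = (\<lambda>k. \<Sum>i<n. ((weight \<xi> i - 1) * ip d (u i) x) * u i k)"

text \<open>By Parseval this sum is the trace of the \<open>q\<close>-th power of
  \<open>M\<close>.\<close>

definition trace_dev :: "nat \<Rightarrow> (nat \<Rightarrow> bool) \<Rightarrow> real" where
  "trace_dev q \<xi> = (\<Sum>i<n. moment d (gram_dev \<xi>) (u i) q)"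

section \<open>Expectations over the sample and discrete integration by parts\<close>

lemma finite_set_sample: "finite (set_pmf sample)"
  by (simp add: sample_def finite_set_Pi_pmf_bool)

lemma integrable_sample [simp]: "integrable sample (f :: (nat \<Rightarrow> bool) \<Rightarrow> real)"
  by (rule integrable_measure_pmf_finite[OF finite_set_sample])

lemma E_mono: "(\<And>\<xi>. f \<xi> \<le> g \<xi>) \<Longrightarrow> E f \<le> E g"
  by (intro integral_mono) auto

text \<open>The sample is a draw of the other coordinates followed by an independent draw of
  coordinate \<open>i\<close>. The right-hand integrand ignores the value at \<open>i\<close>, so it
  may be averaged over the full sample again.\<close>

lemma E_condition:
  assumes "i < n"
  shows "E f = E (\<lambda>\<xi>. p i * f (\<xi>(i := True)) + (1 - p i) * f (\<xi>(i := False)))"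
proof -
  define R where "R = Pi_pmf ({..<n} - {i}) False (\<lambda>i. bernoulli_pmf (p i))"
  have "sample = Pi_pmf (insert i ({..<n} - {i})) False (\<lambda>i. bernoulli_pmf (p i))"
    using assms by (simp add: sample_def insert_absorb)
  also have "\<dots> = map_pmf (\<lambda>(y, f). f(i := y)) (pair_pmf (bernoulli_pmf (p i)) R)"
    by (subst Pi_pmf_insert) (auto simp: R_def)
  also have "\<dots> = bind_pmf R (\<lambda>f. map_pmf (\<lambda>y. f(i := y)) (bernoulli_pmf (p i)))"
    by (subst pair_commute_pmf)
      (simp add: pair_pmf_def map_bind_pmf map_pmf_comp bind_return_pmf bind_assoc_pmf map_pmf_def)
  finally have sample: "sample = bind_pmf R (\<lambda>f. map_pmf (\<lambda>y. f(i := y)) (bernoulli_pmf (p i)))" .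
  have finR: "finite (set_pmf R)"
    by (simp add: R_def finite_set_Pi_pmf_bool)
  have E_R: "E g = (\<Sum>\<xi>\<in>set_pmf R. pmf R \<xi> * (p i * g (\<xi>(i := True)) + (1 - p i) * g (\<xi>(i := False))))" for g
    unfolding sample using p_nonneg[OF assms] p_le_1[OF assms]
    by (subst pmf_expectation_bind[OF finR]) (auto simp: mult.commute)
  show ?thesis
    unfolding E_R[of f] E_R[of "\<lambda>\<xi>. p i * f (\<xi>(i := True)) + (1 - p i) * f (\<xi>(i := False))"]
    by (simp add: algebra_simps)
qed

text \<open>The centred weight is \<open>(1 - p i) / p i\<close> or \<open>- 1\<close>, so after
  multiplication by the probabilities both branches carry \<open>1 - p i\<close> with opposite
  signs. Correlation with the weight thus becomes a discrete derivative in coordinate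
  \<open>i\<close>.\<close>

lemma E_weight_minus_1:
  assumes "i < n" "p i \<noteq> 0"
  shows "E (\<lambda>\<xi>. (weight \<xi> i - 1) * G \<xi>) = (1 - p i) * E (\<lambda>\<xi>. G (\<xi>(i := True)) - G (\<xi>(i := False)))"
proof -
  have "E (\<lambda>\<xi>. (weight \<xi> i - 1) * G \<xi>)
      = E (\<lambda>\<xi>. (1 - p i) * (G (\<xi>(i := True)) - G (\<xi>(i := False))))"
    using assms(2) by (subst E_condition[OF assms(1)]) (simp add: weight_def field_simps)
  then show ?thesis by (simp only: integral_mult_right_zero)
qed

section \<open>Recursion for the trace moments\<close>

lemma ip_gram_dev: "ip d x (gram_dev \<xi> y) = (\<Sum>i<n. (weight \<xi> i - 1) * ip d (u i) y * ip d (u i) x)"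
  by (simp add: gram_dev_def ip_sum_right ip_commute[of d x])

lemma self_adjoint_gram_dev: "self_adjoint d (gram_dev \<xi>)"
  unfolding self_adjoint_def by (simp add: ip_commute[of d "gram_dev _ _"] ip_gram_dev mult_ac)

text \<open>One factor of \<open>M\<close> is expanded into its rank-one terms, and Parseval
  contracts the original trace sum. This exposes the centred weight to which
  \<open>E_weight_minus_1\<close> applies.\<close>

lemma trace_dev_Suc: "trace_dev (Suc q) \<xi> = (\<Sum>i<n. (weight \<xi> i - 1) * moment d (gram_dev \<xi>) (u i) q)"
proof -
  let ?A = "gram_dev \<xi>"
  have "moment d ?A (u j) (Suc q)
      = (\<Sum>i<n. (weight \<xi> i - 1) * (ip d (u j) ((?A ^^ q) (u i)) * ip d (u j) (u i)))" for j
  proof -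
    have "moment d ?A (u j) (Suc q)
        = (\<Sum>i<n. (weight \<xi> i - 1) * ip d (u i) ((?A ^^ q) (u j)) * ip d (u i) (u j))"
      by (simp only: moment_def funpow.simps o_apply ip_gram_dev)
    moreover have "ip d (u i) ((?A ^^ q) (u j)) = ip d (u j) ((?A ^^ q) (u i))" for i
      using self_adjoint_funpow[OF self_adjoint_gram_dev, of q \<xi> "u i" "u j"]
      by (simp only: ip_commute[of d "u j"])
    ultimately show ?thesis
      by (simp only: ip_commute[of d _ "u j"] mult.assoc)
  qed
  then have "trace_dev (Suc q) \<xi>
      = (\<Sum>i<n. \<Sum>j<n. (weight \<xi> i - 1) * (ip d (u j) ((?A ^^ q) (u i)) * ip d (u j) (u i)))"
    by (simp only: trace_dev_def) (rule sum.swap)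
  also have "\<dots> = (\<Sum>i<n. (weight \<xi> i - 1) * ip d ((?A ^^ q) (u i)) (u i))"
    by (simp only: sum_distrib_left[symmetric] parseval)
  also have "\<dots> = (\<Sum>i<n. (weight \<xi> i - 1) * moment d ?A (u i) q)"
    by (simp only: moment_def self_adjoint_funpow[OF self_adjoint_gram_dev])
  finally show ?thesis .
qed

lemma sum_weight_update:
  assumes "i < n"
  shows "(\<Sum>j<n. (weight (\<xi>(i := True)) j - 1) * c j)
    = (\<Sum>j<n. (weight (\<xi>(i := False)) j - 1) * c j) + 1 / p i * c i"
proof -
  have "(\<Sum>j\<in>{..<n} - {i}. (weight (\<xi>(i := True)) j - 1) * c j)
      = (\<Sum>j\<in>{..<n} - {i}. (weight (\<xi>(i := False)) j - 1) * c j)"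
    by (intro sum.cong) (auto simp: weight_def)
  then show ?thesis
    using assms by (simp add: sum.remove[of "{..<n}" i] weight_def left_diff_distrib)
qed

lemma gram_dev_update:
  assumes "i < n"
  shows "ip d x (gram_dev (\<xi>(i := True)) y)
    = ip d x (gram_dev (\<xi>(i := False)) y) + 1 / p i * ip d (u i) y * ip d (u i) x"
  unfolding ip_gram_dev mult.assoc by (rule sum_weight_update[OF assms])

lemma p_eq_0_imp:
  assumes "i < n" "p i = 0"
  shows "ip d (u i) x = 0"
proof -
  have "ip d (u i) (u i) = 0"
    using coherence[OF assms(1)] assms ip_nonneg[of d "u i"] by auto
  then show ?thesis
    using ip_Cauchy_Schwarz[of d "u i" x] by simp
qed

text \<open>For \<open>p i = 1\<close> both sides vanish, which disposes of the rows without a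
  coherence bound; this is why the factor \<open>1 - p i\<close> is kept until here.\<close>

lemma variance_proxy_le:
  assumes "i < n" "p i \<noteq> 0"
  shows "(1 - p i) * (1 / p i) * ip d (u i) (u i) \<le> (1 - p i) * h"
proof (cases "p i = 1")
  case False
  then have "ip d (u i) (u i) / p i \<le> h"
    using coherence[OF assms(1)] p_nonneg[OF assms(1)] assms by (simp add: divide_le_eq)
  from mult_left_mono[OF this, of "1 - p i"] show ?thesis
    using p_le_1[OF assms(1)] by simp
qed simp

text \<open>Discrete integration by parts leaves the change of an odd moment under a rank-one update
  with \<open>t = 1 / p i\<close>, which even moments control.\<close>

lemma E_trace_dev_term_le:
  assumes i: "i < n"
  shows "E (\<lambda>\<xi>. (weight \<xi> i - 1) * moment d (gram_dev \<xi>) (u i) (2 * r + 1))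
    \<le> real (2 * r + 1) * h * E (\<lambda>\<xi>. (weight \<xi> i + 1) * moment d (gram_dev \<xi>) (u i) (2 * r))"
proof (cases "p i = 0")
  case True
  then show ?thesis
    by (simp add: moment_def p_eq_0_imp[OF i])
next
  case False
  define a where "a \<xi> = moment d (gram_dev (\<xi>(i := True))) (u i) (2 * r)" for \<xi>
  define b where "b \<xi> = moment d (gram_dev (\<xi>(i := False))) (u i) (2 * r)" for \<xi>
  have a: "0 \<le> a \<xi>" and b: "0 \<le> b \<xi>" for \<xi>
    unfolding a_def b_def by (rule moment_even_nonneg[OF self_adjoint_gram_dev])+
  have pi: "0 < p i" "p i \<le> 1"
    using p_nonneg[OF i] p_le_1[OF i] False by auto
  have "(1 - p i) * (moment d (gram_dev (\<xi>(i := True))) (u i) (2 * r + 1)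
        - moment d (gram_dev (\<xi>(i := False))) (u i) (2 * r + 1))
      \<le> (2 * r + 1) * h * ((1 + p i) * a \<xi> + (1 - p i) * b \<xi>)" for \<xi>
  proof -
    have "(1 - p i) * (moment d (gram_dev (\<xi>(i := True))) (u i) (2 * r + 1)
        - moment d (gram_dev (\<xi>(i := False))) (u i) (2 * r + 1))
        \<le> (1 - p i) * (1 / p i * (2 * r + 1) * ip d (u i) (u i) * (a \<xi> + b \<xi>))"
      unfolding a_def b_def using pi
      by (intro mult_left_mono moment_rank_one_update_le self_adjoint_gram_dev gram_dev_update i) auto
    also have "\<dots> = (1 - p i) * (1 / p i) * ip d (u i) (u i) * ((2 * r + 1) * (a \<xi> + b \<xi>))"
      by (simp only: mult_ac)
    also have "\<dots> \<le> (1 - p i) * h * ((2 * r + 1) * (a \<xi> + b \<xi>))"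
      using a b by (intro mult_right_mono variance_proxy_le i False) auto
    also have "\<dots> = (2 * r + 1) * h * ((1 - p i) * a \<xi> + (1 - p i) * b \<xi>)"
      by (simp add: algebra_simps)
    \<comment> \<open>Enlarging \<open>1 - p i\<close> to \<open>1 + p i\<close> makes the bracket
      the conditional expectation of \<open>weight \<xi> i + 1\<close> times the moment, so
      \<open>E_condition\<close> can be undone.\<close>
    also have "\<dots> \<le> (2 * r + 1) * h * ((1 + p i) * a \<xi> + (1 - p i) * b \<xi>)"
      using a[of \<xi>] pi h_nonneg by (intro mult_left_mono add_right_mono mult_right_mono) auto
    finally show ?thesis .
  qed
  then have "E (\<lambda>\<xi>. (1 - p i) * (moment d (gram_dev (\<xi>(i := True))) (u i) (2 * r + 1)
        - moment d (gram_dev (\<xi>(i := False))) (u i) (2 * r + 1)))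
      \<le> E (\<lambda>\<xi>. (2 * r + 1) * h * ((1 + p i) * a \<xi> + (1 - p i) * b \<xi>))"
    by (rule E_mono)
  then have "E (\<lambda>\<xi>. (weight \<xi> i - 1) * moment d (gram_dev \<xi>) (u i) (2 * r + 1))
      \<le> real (2 * r + 1) * h * E (\<lambda>\<xi>. (1 + p i) * a \<xi> + (1 - p i) * b \<xi>)"
    unfolding E_weight_minus_1[OF i False] by (simp only: integral_mult_right_zero)
  also have "E (\<lambda>\<xi>. (1 + p i) * a \<xi> + (1 - p i) * b \<xi>)
      = E (\<lambda>\<xi>. (weight \<xi> i + 1) * moment d (gram_dev \<xi>) (u i) (2 * r))"
    unfolding a_def b_def using False
    by (subst (2) E_condition[OF i]) (simp add: weight_def field_simps)
  finally show ?thesis .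
qed

text \<open>After summation over \<open>i\<close>, the split of \<open>weight + 1\<close> into
  \<open>(weight - 1) + 2\<close> turns the right-hand side back into trace moments.\<close>

lemma E_trace_dev_step:
  "E (trace_dev (2 * r + 2)) \<le> real (2 * r + 1) * h * (E (trace_dev (2 * r + 1)) + 2 * E (trace_dev (2 * r)))"
proof -
  have "E (trace_dev (2 * r + 2))
      = (\<Sum>i<n. E (\<lambda>\<xi>. (weight \<xi> i - 1) * moment d (gram_dev \<xi>) (u i) (2 * r + 1)))"
  proof -
    have "trace_dev (2 * r + 2) = (\<lambda>\<xi>. \<Sum>i<n. (weight \<xi> i - 1) * moment d (gram_dev \<xi>) (u i) (2 * r + 1))"
      using trace_dev_Suc[of "2 * r + 1"] by (intro ext) simp
    then show ?thesis
      by (simp only: Bochner_Integration.integral_sum integrable_sample)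
  qed
  also have "\<dots> \<le> (\<Sum>i<n. real (2 * r + 1) * h * E (\<lambda>\<xi>. (weight \<xi> i + 1) * moment d (gram_dev \<xi>) (u i) (2 * r)))"
    by (intro sum_mono E_trace_dev_term_le) simp
  also have "\<dots> = real (2 * r + 1) * h * E (\<lambda>\<xi>. \<Sum>i<n. (weight \<xi> i + 1) * moment d (gram_dev \<xi>) (u i) (2 * r))"
    by (simp add: sum_distrib_left)
  also have "(\<lambda>\<xi>. \<Sum>i<n. (weight \<xi> i + 1) * moment d (gram_dev \<xi>) (u i) (2 * r))
      = (\<lambda>\<xi>. trace_dev (2 * r + 1) \<xi> + 2 * trace_dev (2 * r) \<xi>)"
  proof
    fix \<xi>
    show "(\<Sum>i<n. (weight \<xi> i + 1) * moment d (gram_dev \<xi>) (u i) (2 * r))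
      = trace_dev (2 * r + 1) \<xi> + 2 * trace_dev (2 * r) \<xi>"
      unfolding Suc_eq_plus1[symmetric] trace_dev_Suc
      unfolding trace_dev_def sum_distrib_left sum.distrib[symmetric]
      by (intro sum.cong) (auto simp: algebra_simps)
  qed
  finally show ?thesis
    by simp
qed

lemma trace_dev_even_nonneg: "0 \<le> trace_dev (2 * r) \<xi>"
  unfolding trace_dev_def by (intro sum_nonneg moment_even_nonneg self_adjoint_gram_dev)

lemma E_trace_dev_even_nonneg: "0 \<le> E (trace_dev (2 * r))"
  by (intro Bochner_Integration.integral_nonneg trace_dev_even_nonneg)

lemma trace_dev_odd_le: "2 * trace_dev (2 * r + 1) \<xi> \<le> trace_dev (2 * r + 2) \<xi> + trace_dev (2 * r) \<xi>"
proof -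
  have "2 * moment d (gram_dev \<xi>) (u i) (2 * r + 1)
      \<le> moment d (gram_dev \<xi>) (u i) (2 * r + 2) + moment d (gram_dev \<xi>) (u i) (2 * r)" for i
    by (rule moment_odd_le[OF self_adjoint_gram_dev])
  then have "(\<Sum>i<n. 2 * moment d (gram_dev \<xi>) (u i) (2 * r + 1))
      \<le> (\<Sum>i<n. moment d (gram_dev \<xi>) (u i) (2 * r + 2) + moment d (gram_dev \<xi>) (u i) (2 * r))"
    by (intro sum_mono) blast
  then show ?thesis
    by (simp only: trace_dev_def sum_distrib_left sum.distrib)
qed

text \<open>The odd moment is at most the mean of its neighbours. As the prefactor is at most 1, the
  resulting half of the new even moment is absorbed on the left, which produces the 5.\<close>

lemma E_trace_dev_step_even:
  assumes "real (2 * r + 1) * h \<le> 1"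
  shows "E (trace_dev (2 * r + 2)) \<le> 5 * (real (2 * r + 1) * h) * E (trace_dev (2 * r))"
proof -
  define s where "s = real (2 * r + 1) * h"
  define T T' where "T = E (trace_dev (2 * r))" and "T' = E (trace_dev (2 * r + 2))"
  have "0 \<le> s" "s \<le> 1"
    using assms h_nonneg by (auto simp: s_def)
  have "0 \<le> T'"
    unfolding T'_def using E_trace_dev_even_nonneg[of "r + 1"] by simp
  have "2 * E (trace_dev (2 * r + 1)) \<le> T' + T"
    using E_mono[OF trace_dev_odd_le[of r]] by (simp add: T_def T'_def)
  with \<open>0 \<le> s\<close> have "s * (E (trace_dev (2 * r + 1)) + 2 * T) \<le> s * ((T' + 5 * T) / 2)"
    by (intro mult_left_mono) auto
  moreover have "T' \<le> s * (E (trace_dev (2 * r + 1)) + 2 * T)"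
    unfolding s_def T_def T'_def by (rule E_trace_dev_step)
  ultimately have "T' \<le> s * ((T' + 5 * T) / 2)"
    by linarith
  moreover have "s * T' \<le> T'"
    using \<open>s \<le> 1\<close> \<open>0 \<le> T'\<close> by (simp add: mult_left_le_one_le \<open>0 \<le> s\<close>)
  ultimately have "T' \<le> 5 * s * T"
    by (simp add: algebra_simps)
  then show ?thesis by (simp add: s_def T_def T'_def)
qed

text \<open>Fixing \<open>P\<close> while \<open>r\<close> runs up to it gives every step the same
  ratio, because \<open>2 * r + 1\<close> stays below \<open>2 * P\<close>.\<close>

lemma E_trace_dev_le:
  assumes "2 * real P * h \<le> 1" "r \<le> P"
  shows "E (trace_dev (2 * r)) \<le> (10 * real P * h) ^ r * (\<Sum>i<n. ip d (u i) (u i))"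
  using assms(2)
proof (induction r)
  case 0
  then show ?case by (simp add: trace_dev_def moment_0)
next
  case (Suc r)
  have le: "real (2 * r + 1) * h \<le> 2 * real P * h"
    using Suc.prems h_nonneg by (intro mult_right_mono) auto
  have le': "5 * (real (2 * r + 1) * h) \<le> 10 * real P * h"
    using mult_left_mono[OF le, of 5] by simp
  have "E (trace_dev (2 * Suc r)) \<le> 5 * (real (2 * r + 1) * h) * E (trace_dev (2 * r))"
    using E_trace_dev_step_even[OF order_trans[OF le assms(1)]] by simp
  also have "\<dots> \<le> (10 * real P * h) * E (trace_dev (2 * r))"
    by (intro mult_right_mono E_trace_dev_even_nonneg le')
  also have "\<dots> \<le> (10 * real P * h) * ((10 * real P * h) ^ r * (\<Sum>i<n. ip d (u i) (u i)))"
    using Suc h_nonneg by (intro mult_left_mono) auto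
  finally show ?case by (simp add: mult_ac)
qed

section \<open>Lower tail of the sampled Gram matrix\<close>

text \<open>An even power is positive semidefinite, so its largest eigenvalue is at most its trace;
  Parseval and Cauchy-Schwarz give this without a spectrum.\<close>

lemma moment_even_le_trace_dev:
  "moment d (gram_dev \<xi>) z (2 * r) \<le> trace_dev (2 * r) \<xi> * ip d z z"
proof -
  let ?A = "gram_dev \<xi>"
  note sa = self_adjoint_gram_dev[of \<xi>]
  have "moment d ?A z (2 * r) = (\<Sum>i<n. (ip d (u i) ((?A ^^ r) z))\<^sup>2)"
    unfolding mult_2 ip_funpow_funpow[OF sa, symmetric] power2_eq_square by (rule parseval[symmetric])
  also have "\<dots> \<le> (\<Sum>i<n. moment d ?A (u i) (2 * r) * ip d z z)"
    unfolding mult_2 ip_funpow_funpow[OF sa, symmetric] self_adjoint_funpow[OF sa, symmetric]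
    by (intro sum_mono order_trans[OF ip_Cauchy_Schwarz]) (simp add: self_adjoint_funpow[OF sa])
  finally show ?thesis
    by (simp add: trace_dev_def sum_distrib_right)
qed

text \<open>The hypothesis puts the normalized first moment at \<open>z\<close> below
  \<open>-1/2\<close>, hence the second above \<open>1/4\<close>. By log-convexity the ratios of
  consecutive even moments do not decrease, so each is at least \<open>1/4\<close>.\<close>

lemma trace_dev_ge:
  assumes "2 * (\<Sum>i<n. weight \<xi> i * (ip d (u i) z)\<^sup>2) < ip d z z"
  shows "(1 / 4) ^ r \<le> trace_dev (2 * r) \<xi>"
proof -
  let ?m = "moment d (gram_dev \<xi>) z"
  note sa = self_adjoint_gram_dev[of \<xi>]
  have nn: "0 \<le> ?m (2 * j)" for j
    by (rule moment_even_nonneg[OF sa])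
  have "?m 1 = (\<Sum>i<n. weight \<xi> i * (ip d (u i) z)\<^sup>2) - ip d z z"
    by (simp add: moment_def ip_gram_dev power2_eq_square algebra_simps sum_subtractf parseval)
  then have m1: "2 * ?m 1 < - ?m 0"
    using assms by (simp add: moment_0)
  \<comment> \<open>The strict inequality in the hypothesis excludes the zero direction, so the
    moments can be divided by \<open>?m 0\<close>.\<close>
  have "0 < ip d z z"
  proof (rule ccontr)
    assume "\<not> ?thesis"
    then have "ip d z z = 0"
      using ip_nonneg[of d z] by simp
    then have "ip d (u i) z = 0" for i
      using ip_Cauchy_Schwarz[of d "u i" z] by simp
    with assms \<open>ip d z z = 0\<close> show False by simp
  qed
  then have m0: "0 < ?m 0" by (simp add: moment_0)
  have step: "0 < ?m (2 * j) \<and> ?m (2 * j) \<le> 4 * ?m (2 * (j + 1))" for j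
  proof (induction j)
    case 0
    have "?m 0 * ?m 0 \<le> (- 2 * ?m 1) * (- 2 * ?m 1)"
      using m0 m1 by (intro mult_mono) auto
    also have "\<dots> \<le> ?m 0 * (4 * ?m 2)"
      using moment_Cauchy_Schwarz[OF sa, of z 0 1] by (simp add: power2_eq_square)
    finally show ?case
      using m0 by simp
  next
    case (Suc j)
    then have pos: "0 < ?m (2 * (j + 1))" by linarith
    have "?m (2 * (j + 1)) * ?m (2 * (j + 1)) \<le> ?m (2 * j) * ?m (2 * (j + 2))"
    proof -
      have "j + (j + 2) = 2 * (j + 1)"
        by simp
      then show ?thesis
        using moment_Cauchy_Schwarz[OF sa, of z j "j + 2"] by (simp only: power2_eq_square)
    qed
    also have "\<dots> \<le> 4 * ?m (2 * (j + 1)) * ?m (2 * (j + 2))"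
      using Suc nn[of "j + 2"] by (intro mult_right_mono) auto
    finally show ?case
      using pos by (simp add: mult.commute mult.left_commute)
  qed
  have "(1 / 4) ^ r * ?m 0 \<le> ?m (2 * r)"
  proof (induction r)
    case (Suc r)
    then show ?case
      using step[of r] by simp
  qed simp
  then have "(1 / 4) ^ r * ip d z z \<le> trace_dev (2 * r) \<xi> * ip d z z"
    using moment_even_le_trace_dev[of \<xi> z r] by (simp add: moment_0)
  then show ?thesis
    using \<open>0 < ip d z z\<close> by simp
qed

lemma prob_markov:
  assumes "\<And>\<xi>. 0 \<le> f \<xi>" "0 < a"
  shows "measure_pmf.prob sample {\<xi>. a \<le> f \<xi>} \<le> E f / a"
  using integral_Markov_inequality_measure[of sample f "{}" a] assms by simp

text \<open>Markov's inequality is applied to the trace, which does not depend on \<open>z\<close>;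
  the union over all directions therefore costs nothing. The threshold turns the factor 10 into
  40.\<close>

lemma prob_gram_lower_tail:
  assumes "2 * real P * h \<le> 1"
  shows "measure_pmf.prob sample
      {\<xi>. \<exists>z. 2 * (\<Sum>i<n. weight \<xi> i * (ip d (u i) z)\<^sup>2) < ip d z z}
    \<le> (40 * real P * h) ^ P * (\<Sum>i<n. ip d (u i) (u i))"
proof -
  have "measure_pmf.prob sample
      {\<xi>. \<exists>z. 2 * (\<Sum>i<n. weight \<xi> i * (ip d (u i) z)\<^sup>2) < ip d z z}
      \<le> measure_pmf.prob sample {\<xi>. (1 / 4) ^ P \<le> trace_dev (2 * P) \<xi>}"
    using trace_dev_ge by (intro measure_pmf.finite_measure_mono) auto
  also have "\<dots> \<le> E (trace_dev (2 * P)) / (1 / 4) ^ P"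
    by (intro prob_markov trace_dev_even_nonneg) simp
  also have "\<dots> = 4 ^ P * E (trace_dev (2 * P))"
    by (simp add: power_one_over)
  also have "\<dots> \<le> 4 ^ P * ((10 * real P * h) ^ P * (\<Sum>i<n. ip d (u i) (u i)))"
    by (rule mult_left_mono[OF E_trace_dev_le[OF assms order_refl]]) simp
  also have "\<dots> = (4 * (10 * real P * h)) ^ P * (\<Sum>i<n. ip d (u i) (u i))"
    by (simp only: power_mult_distrib mult.assoc)
  also have "4 * (10 * real P * h) = 40 * real P * h"
    by simp
  finally show ?thesis .
qed

section \<open>Variance of the cross term\<close>

text \<open>The deviation of the sampled product \<open>U^T r\<close> from the exact one, which is
  zero for the least-squares residual.\<close>

definition cross_dev :: "(nat \<Rightarrow> real) \<Rightarrow> (nat \<Rightarrow> bool) \<Rightarrow> nat \<Rightarrow> real" where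
  "cross_dev r \<xi> = (\<lambda>k. \<Sum>i<n. ((weight \<xi> i - 1) * r i) * u i k)"

lemma ip_cross_dev: "ip d x (cross_dev r \<xi>) = (\<Sum>i<n. (weight \<xi> i - 1) * r i * ip d (u i) x)"
  by (simp add: cross_dev_def ip_sum_right ip_commute[of d x])

text \<open>One copy of \<open>cross_dev\<close> serves as test function for the other. It is affine
  in each weight, so its discrete derivative is deterministic and only diagonal terms
  survive.\<close>

lemma E_cross_dev_le: "E (\<lambda>\<xi>. ip d (cross_dev r \<xi>) (cross_dev r \<xi>)) \<le> h * (\<Sum>i<n. (r i)\<^sup>2)"
proof -
  have "E (\<lambda>\<xi>. ip d (cross_dev r \<xi>) (cross_dev r \<xi>))
      = (\<Sum>i<n. E (\<lambda>\<xi>. (weight \<xi> i - 1) * (r i * ip d (u i) (cross_dev r \<xi>))))"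
    by (subst ip_cross_dev) (simp add: Bochner_Integration.integral_sum mult.assoc)
  also have "\<dots> \<le> (\<Sum>i<n. h * (r i)\<^sup>2)"
  proof (rule sum_mono)
    fix i assume "i \<in> {..<n}"
    then have i: "i < n" by simp
    show "E (\<lambda>\<xi>. (weight \<xi> i - 1) * (r i * ip d (u i) (cross_dev r \<xi>))) \<le> h * (r i)\<^sup>2"
    proof (cases "p i = 0")
      case True
      then show ?thesis
        using h_nonneg by (simp add: p_eq_0_imp[OF i])
    next
      case False
      have "r i * ip d (u i) (cross_dev r (\<xi>(i := True))) - r i * ip d (u i) (cross_dev r (\<xi>(i := False)))
          = 1 / p i * ip d (u i) (u i) * (r i)\<^sup>2" for \<xi>
        unfolding right_diff_distrib[symmetric] ip_cross_dev mult.assoc sum_weight_update[OF i]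
        by (simp add: power2_eq_square)
      then have "E (\<lambda>\<xi>. (weight \<xi> i - 1) * (r i * ip d (u i) (cross_dev r \<xi>)))
          = (1 - p i) * (1 / p i) * ip d (u i) (u i) * (r i)\<^sup>2"
        by (simp add: E_weight_minus_1[OF i False])
      also have "\<dots> \<le> (1 - p i) * h * (r i)\<^sup>2"
        by (intro mult_right_mono variance_proxy_le i False) auto
      also have "\<dots> \<le> 1 * h * (r i)\<^sup>2"
        using p_nonneg[OF i] h_nonneg by (intro mult_right_mono) auto
      finally show ?thesis by simp
    qed
  qed
  finally show ?thesis by (simp add: sum_distrib_left)
qed

lemma prob_cross_dev:
  assumes "0 < \<epsilon>"
  shows "measure_pmf.prob sample
      {\<xi>. \<epsilon> * (\<Sum>i<n. (r i)\<^sup>2) < 4 * ip d (cross_dev r \<xi>) (cross_dev r \<xi>)} \<le> 4 * h / \<epsilon>"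
proof (cases "(\<Sum>i<n. (r i)\<^sup>2) = 0")
  \<comment> \<open>With zero residual Markov's threshold would be 0; the event is empty instead,
    since its inequality is strict.\<close>
  case True
  then have "cross_dev r \<xi> = (\<lambda>_. 0)" for \<xi>
    by (simp add: cross_dev_def sum_nonneg_eq_0_iff)
  then show ?thesis
    using True assms h_nonneg by (simp add: ip_def)
next
  case False
  define R where "R = (\<Sum>i<n. (r i)\<^sup>2)"
  have "0 < R"
    using False sum_nonneg[of "{..<n}" "\<lambda>i. (r i)\<^sup>2"] by (simp add: R_def)
  have "measure_pmf.prob sample {\<xi>. \<epsilon> * R < 4 * ip d (cross_dev r \<xi>) (cross_dev r \<xi>)}
      \<le> measure_pmf.prob sample {\<xi>. \<epsilon> * R / 4 \<le> ip d (cross_dev r \<xi>) (cross_dev r \<xi>)}"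
    by (intro measure_pmf.finite_measure_mono) auto
  also have "\<dots> \<le> E (\<lambda>\<xi>. ip d (cross_dev r \<xi>) (cross_dev r \<xi>)) / (\<epsilon> * R / 4)"
    using assms \<open>0 < R\<close> by (intro prob_markov ip_nonneg) simp
  also have "\<dots> \<le> (h * R) / (\<epsilon> * R / 4)"
    using E_cross_dev_le[of r] assms \<open>0 < R\<close> unfolding R_def[symmetric]
    by (intro divide_right_mono) auto
  also have "\<dots> = 4 * h / \<epsilon>"
    using assms \<open>0 < R\<close> by (simp add: field_simps)
  finally show ?thesis by (simp add: R_def)
qed

end

section \<open>Least squares and the sampling matrix\<close>

lemma scalar_prod_self_nonneg: "0 \<le> v \<bullet> (v :: real vec)"
  by (simp add: scalar_prod_def sum_nonneg)

lemma l2_norm_sq: "(l2_norm v)\<^sup>2 = v \<bullet> v"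
  by (simp add: l2_norm_def scalar_prod_self_nonneg)

lemma scalar_prod_eq_ip: "w \<in> carrier_vec d \<Longrightarrow> v \<bullet> w = ip d (vec_index v) (vec_index w)"
  by (simp add: scalar_prod_def ip_def atLeast0LessThan)

lemma scalar_prod_minus_self:
  fixes v w :: "real vec"
  assumes "v \<in> carrier_vec n" "w \<in> carrier_vec n"
  shows "(v - t \<cdot>\<^sub>v w) \<bullet> (v - t \<cdot>\<^sub>v w) = v \<bullet> v - 2 * t * (w \<bullet> v) + t\<^sup>2 * (w \<bullet> w)"
proof -
  have "(\<Sum>i<n. (v $ i - t * w $ i) * (v $ i - t * w $ i))
      = (\<Sum>i<n. v $ i * v $ i) - 2 * t * (\<Sum>i<n. w $ i * v $ i) + t\<^sup>2 * (\<Sum>i<n. w $ i * w $ i)"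
    by (simp add: sum_distrib_left sum.distrib[symmetric] sum_subtractf[symmetric]
        algebra_simps power2_eq_square)
  then show ?thesis
    using assms by (simp add: scalar_prod_def atLeast0LessThan)
qed

text \<open>Along the line through \<beta> in direction \<delta> the objective is a quadratic in
  \<open>t\<close> with minimum at 0, so its linear coefficient vanishes.\<close>

lemma lsq_solution_normal_eq:
  assumes A: "A \<in> carrier_mat m k" and b: "b \<in> carrier_vec m"
    and sol: "lsq_solution A b \<beta>" and \<delta>: "\<delta> \<in> carrier_vec k"
  shows "(A *\<^sub>v \<delta>) \<bullet> (b - A *\<^sub>v \<beta>) = 0"
proof -
  define e where "e = b - A *\<^sub>v \<beta>"
  define w where "w = A *\<^sub>v \<delta>"
  define s where "s = w \<bullet> e"
  define q where "q = w \<bullet> w"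
  have \<beta>: "\<beta> \<in> carrier_vec k"
    using sol A by (simp add: lsq_solution_def is_arg_min_def)
  have e: "e \<in> carrier_vec m" and w: "w \<in> carrier_vec m"
    using A b \<beta> \<delta> by (auto simp: e_def w_def)
  have "e \<bullet> e \<le> e \<bullet> e - 2 * t * s + t\<^sup>2 * q" for t
  proof -
    have \<beta>t: "\<beta> + t \<cdot>\<^sub>v \<delta> \<in> carrier_vec k"
      using \<beta> \<delta> by simp
    have "b - A *\<^sub>v (\<beta> + t \<cdot>\<^sub>v \<delta>) = e - t \<cdot>\<^sub>v w"
      using A b \<beta> \<delta>
      by (intro eq_vecI) (auto simp: e_def w_def mult_add_distrib_mat_vec[OF A] mult_mat_vec[OF A])
    moreover have "(l2_norm (b - A *\<^sub>v \<beta>))\<^sup>2 \<le> (l2_norm (b - A *\<^sub>v (\<beta> + t \<cdot>\<^sub>v \<delta>)))\<^sup>2"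
      using sol \<beta>t A by (simp add: lsq_solution_def is_arg_min_def not_less)
    ultimately show ?thesis
      by (simp add: l2_norm_sq scalar_prod_minus_self[OF e w] s_def q_def flip: e_def)
  qed
  \<comment> \<open>The exact minimizer would be \<open>s / q\<close>; the denominator
    \<open>q + 1\<close> also covers \<open>q = 0\<close>.\<close>
  from this[of "s / (q + 1)"] have *: "2 * (s / (q + 1)) * s \<le> (s / (q + 1))\<^sup>2 * q"
    by simp
  have "0 \<le> q"
    by (simp add: q_def scalar_prod_self_nonneg)
  then have "(s / (q + 1))\<^sup>2 * q \<le> (s / (q + 1))\<^sup>2 * (q + 1)"
    by (intro mult_left_mono) auto
  also have "\<dots> = s\<^sup>2 / (q + 1)"
    using \<open>0 \<le> q\<close> by (simp add: power2_eq_square)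
  finally have "s\<^sup>2 / (q + 1) \<le> 0"
    using * by (simp add: power2_eq_square)
  then have "s\<^sup>2 \<le> 0"
    using \<open>0 \<le> q\<close> by (simp add: divide_le_0_iff)
  then show ?thesis
    by (simp add: s_def e_def w_def)
qed

lemma isometry_scalar_prod:
  fixes Q :: "real mat"
  assumes Q: "Q \<in> carrier_mat n d" and "Q\<^sup>T * Q = 1\<^sub>m d"
    and x: "x \<in> carrier_vec d" and y: "y \<in> carrier_vec d"
  shows "(Q *\<^sub>v x) \<bullet> (Q *\<^sub>v y) = x \<bullet> y"
proof -
  have "Q\<^sup>T *\<^sub>v (Q *\<^sub>v x) = x"
    using assoc_mult_mat_vec[of "Q\<^sup>T" d n Q d x] assms by simp
  then show ?thesis
    using transpose_vec_mult_scalar[OF Q y, of "Q *\<^sub>v x"] Q x by simp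
qed

lemma sum_ip_rows:
  fixes U :: "real mat"
  assumes U: "U \<in> carrier_mat n d" and "U\<^sup>T * U = 1\<^sub>m d"
  shows "(\<Sum>i<n. ip d (\<lambda>k. U $$ (i, k)) x * ip d (\<lambda>k. U $$ (i, k)) y) = ip d x y"
proof -
  have "ip d (\<lambda>k. U $$ (i, k)) z = (U *\<^sub>v vec d z) $ i" if "i < n" for i z
    using that U by (simp add: ip_def scalar_prod_def atLeast0LessThan)
  then have "(\<Sum>i<n. ip d (\<lambda>k. U $$ (i, k)) x * ip d (\<lambda>k. U $$ (i, k)) y)
      = (U *\<^sub>v vec d x) \<bullet> (U *\<^sub>v vec d y)"
    using U by (simp add: scalar_prod_def atLeast0LessThan)
  also have "\<dots> = vec d x \<bullet> vec d y"
    by (rule isometry_scalar_prod[OF assms]) auto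
  finally show ?thesis
    by (simp add: scalar_prod_def ip_def atLeast0LessThan)
qed

text \<open>The total of the leverage scores, as the trace of \<open>U^T U\<close>; it starts the
  moment recursion and is the dimension factor in the tail bound.\<close>

lemma sum_ip_rows_self:
  fixes U :: "real mat"
  assumes U: "U \<in> carrier_mat n d" and UU: "U\<^sup>T * U = 1\<^sub>m d"
  shows "(\<Sum>i<n. ip d (\<lambda>k. U $$ (i, k)) (\<lambda>k. U $$ (i, k))) = real d"
proof -
  have "(\<Sum>i<n. ip d (\<lambda>k. U $$ (i, k)) (\<lambda>k. U $$ (i, k))) = (\<Sum>k<d. (U\<^sup>T * U) $$ (k, k))"
    unfolding ip_def using U by (subst sum.swap) (simp add: scalar_prod_def atLeast0LessThan)
  then show ?thesis
    by (simp add: UU)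
qed

lemma mult_diagonal_mat_vec:
  fixes D :: "real mat"
  assumes "D \<in> carrier_mat d d" "diagonal_mat D" "x \<in> carrier_vec d" "i < d"
  shows "(D *\<^sub>v x) $ i = D $$ (i, i) * x $ i"
proof -
  have "(D *\<^sub>v x) $ i = (\<Sum>j<d. D $$ (i, j) * x $ j)"
    using assms by (simp add: scalar_prod_def atLeast0LessThan)
  also have "\<dots> = (\<Sum>j<d. if j = i then D $$ (i, i) * x $ i else 0)"
    using assms by (intro sum.cong) (auto simp: diagonal_mat_def)
  finally show ?thesis
    using assms by simp
qed

lemma sigma_bounds:
  assumes "\<Sigma> \<in> carrier_mat d d" "i < d"
  shows "sigma_min \<Sigma> \<le> \<Sigma> $$ (i, i)" "\<Sigma> $$ (i, i) \<le> sigma_max \<Sigma>"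
proof -
  have "\<Sigma> $$ (i, i) \<in> set (diag_mat \<Sigma>)"
    using assms by (auto simp: diag_mat_def)
  then show "sigma_min \<Sigma> \<le> \<Sigma> $$ (i, i)" "\<Sigma> $$ (i, i) \<le> sigma_max \<Sigma>"
    by (auto simp: sigma_min_def sigma_max_def)
qed

lemma sigma_mult_vec_bounds:
  assumes S: "\<Sigma> \<in> carrier_mat d d" "diagonal_mat \<Sigma>" and pos: "0 \<le> sigma_min \<Sigma>"
    and x: "x \<in> carrier_vec d"
  shows "(sigma_min \<Sigma>)\<^sup>2 * (x \<bullet> x) \<le> (\<Sigma> *\<^sub>v x) \<bullet> (\<Sigma> *\<^sub>v x)"
    and "(\<Sigma> *\<^sub>v x) \<bullet> (\<Sigma> *\<^sub>v x) \<le> (sigma_max \<Sigma>)\<^sup>2 * (x \<bullet> x)"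
proof -
  have eq: "(\<Sigma> *\<^sub>v x) \<bullet> (\<Sigma> *\<^sub>v x) = (\<Sum>i<d. (\<Sigma> $$ (i, i))\<^sup>2 * (x $ i * x $ i))"
    using S x mult_diagonal_mat_vec[OF S x]
    by (simp add: scalar_prod_def[of _ "\<Sigma> *\<^sub>v x"] atLeast0LessThan power2_eq_square mult_ac
        del: index_mult_mat_vec)
  have xx: "x \<bullet> x = (\<Sum>i<d. x $ i * x $ i)"
    using x by (simp add: scalar_prod_def atLeast0LessThan)
  show "(sigma_min \<Sigma>)\<^sup>2 * (x \<bullet> x) \<le> (\<Sigma> *\<^sub>v x) \<bullet> (\<Sigma> *\<^sub>v x)"
    unfolding eq xx sum_distrib_left
    using sigma_bounds[OF S(1)] pos by (intro sum_mono mult_right_mono power_mono) auto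
  show "(\<Sigma> *\<^sub>v x) \<bullet> (\<Sigma> *\<^sub>v x) \<le> (sigma_max \<Sigma>)\<^sup>2 * (x \<bullet> x)"
    unfolding eq xx sum_distrib_left
    using sigma_bounds[OF S(1)] pos
    by (intro sum_mono mult_right_mono power_mono) (auto intro: order_trans)
qed

section \<open>The sampling matrix as a weighted inner product\<close>

text \<open>This turns sums over the rows of a \<open>submatrix\<close> into sums over the index
  set.\<close>

lemma bij_betw_pick:
  assumes "finite C"
  shows "bij_betw (pick C) {..<card C} C"
proof -
  have "inj_on (pick C) {..<card C}"
    by (rule linorder_inj_onI) (auto dest: pick_mono_le)
  moreover have "pick C ` {..<card C} \<subseteq> C"
    by (auto simp: pick_in_set_le)
  ultimately show ?thesis
    using assms by (simp add: bij_betw_def card_image card_subset_eq)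
qed

lemma sampling_mat_carrier:
  assumes "dim_row U = n" "C \<subseteq> {..<n}"
  shows "sampling_mat U c C \<in> carrier_mat (card C) n"
proof -
  have "{i. i < n \<and> i \<in> C} = C"
    using assms by auto
  then show ?thesis
    using assms by (intro carrier_matI)
      (simp_all add: sampling_mat_def dim_submatrix rescaling_mat_def mat_diag_def)
qed

text \<open>Row \<open>k\<close> has its only possibly nonzero entry, the square root of the inverse
  probability, in column \<open>pick C k\<close>; in the product two such roots combine to the
  weight.\<close>

lemma sampling_mat_scalar_prod:
  assumes U: "dim_row U = n" and C: "C \<subseteq> {..<n}"
    and v: "v \<in> carrier_vec n" and w: "w \<in> carrier_vec n"
  shows "(sampling_mat U c C *\<^sub>v v) \<bullet> (sampling_mat U c C *\<^sub>v w)
    = (\<Sum>i<n. of_bool (i \<in> C) / sampling_prob U c i * (v $ i * w $ i))"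
proof -
  let ?S = "sampling_mat U c C"
  let ?p = "sampling_prob U c"
  note S = sampling_mat_carrier[OF U C, of c]
  have finC: "finite C"
    using C finite_subset by blast
  have Ceq: "{i. i < n \<and> i \<in> C} = C"
    using C by auto
  have p_nonneg: "0 \<le> ?p i" for i
    by (simp add: sampling_prob_def leverage_score_def)
  have entry: "(?S *\<^sub>v x) $ k = sqrt (1 / ?p (pick C k)) * x $ (pick C k)"
    if k: "k < card C" and x: "x \<in> carrier_vec n" for k x
  proof -
    have pk: "pick C k < n"
      using C pick_in_set_le[OF k] by auto
    have "(?S *\<^sub>v x) $ k = (\<Sum>j<n. ?S $$ (k, j) * x $ j)"
      using S k x by (simp add: scalar_prod_def atLeast0LessThan)
    also have "\<dots> = (\<Sum>j<n. if j = pick C k then sqrt (1 / ?p (pick C k)) * x $ (pick C k) else 0)"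
    proof (intro sum.cong refl)
      fix j assume "j \<in> {..<n}"
      then have "?S $$ (k, j) = map_mat sqrt (rescaling_mat U c) $$ (pick C k, pick UNIV j)"
        unfolding sampling_mat_def using k U
        by (intro submatrix_index) (simp_all add: rescaling_mat_def mat_diag_def Ceq)
      then show "?S $$ (k, j) * x $ j
          = (if j = pick C k then sqrt (1 / ?p (pick C k)) * x $ (pick C k) else 0)"
        using pk U \<open>j \<in> {..<n}\<close> by (simp add: pick_UNIV rescaling_mat_def mat_diag_def)
    qed
    finally show ?thesis
      using pk by simp
  qed
  have "(?S *\<^sub>v v) \<bullet> (?S *\<^sub>v w) = (\<Sum>k<card C. (?S *\<^sub>v v) $ k * (?S *\<^sub>v w) $ k)"
    using S by (simp add: scalar_prod_def[of _ "?S *\<^sub>v w"] atLeast0LessThan del: index_mult_mat_vec)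
  also have "\<dots> = (\<Sum>k<card C. 1 / ?p (pick C k) * (v $ pick C k * w $ pick C k))"
  proof (intro sum.cong refl)
    fix k assume "k \<in> {..<card C}"
    then have k: "k < card C" by simp
    have "sqrt (1 / ?p (pick C k)) * sqrt (1 / ?p (pick C k)) = 1 / ?p (pick C k)"
      using p_nonneg by simp
    then show "(?S *\<^sub>v v) $ k * (?S *\<^sub>v w) $ k = 1 / ?p (pick C k) * (v $ pick C k * w $ pick C k)"
      unfolding entry[OF k v] entry[OF k w] by (simp only: mult_ac)
  qed
  also have "\<dots> = (\<Sum>i\<in>C. 1 / ?p i * (v $ i * w $ i))"
    using sum.reindex_bij_betw[OF bij_betw_pick[OF finC], of "\<lambda>i. 1 / ?p i * (v $ i * w $ i)"] .
  also have "\<dots> = (\<Sum>i<n. of_bool (i \<in> C) / ?p i * (v $ i * w $ i))"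
    using C by (intro sum.mono_neutral_cong_left) auto
  finally show ?thesis .
qed

section \<open>Deterministic error bounds\<close>

lemma thin_svd_mult_vec:
  assumes X: "X \<in> carrier_mat n d" and svd: "thin_svd X U \<Sigma> V" and x: "x \<in> carrier_vec d"
  shows "X *\<^sub>v x = U *\<^sub>v (\<Sigma> *\<^sub>v (V\<^sup>T *\<^sub>v x))"
proof -
  have U: "U \<in> carrier_mat n d" and \<Sigma>: "\<Sigma> \<in> carrier_mat d d" and V: "V\<^sup>T \<in> carrier_mat d d"
    and X_eq: "X = U * \<Sigma> * V\<^sup>T"
    using svd X by (auto simp: thin_svd_def)
  have "X *\<^sub>v x = U * \<Sigma> *\<^sub>v (V\<^sup>T *\<^sub>v x)"
    unfolding X_eq by (rule assoc_mult_mat_vec[OF mult_carrier_mat[OF U \<Sigma>] V x])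
  also have "\<dots> = U *\<^sub>v (\<Sigma> *\<^sub>v (V\<^sup>T *\<^sub>v x))"
    by (rule assoc_mult_mat_vec[OF U \<Sigma> mult_mat_vec_carrier[OF V x]])
  finally show ?thesis .
qed

text \<open>
  With \<open>\<delta> = \<beta> - \<beta>\<^sub>S\<close> and \<open>z = \<Sigma> V\<^sup>T \<delta>\<close>, testing the normal equations of the
  sketched problem against \<open>\<delta>\<close> bounds \<open>z\<close> by the cross term of the sampled residual.
\<close>

lemma sketched_solution_bound:
  fixes X U \<Sigma> V S :: "real mat" and y r \<beta> \<beta>\<^sub>S :: "real vec" and wt :: "nat \<Rightarrow> real" and n :: nat
  defines "u \<equiv> \<lambda>i k. U $$ (i, k)"
  defines "r \<equiv> y - X *\<^sub>v \<beta>"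
  defines "g \<equiv> \<lambda>k. \<Sum>i<n. ((wt i - 1) * r $ i) * u i k"
  assumes X: "X \<in> carrier_mat n d" and svd: "thin_svd X U \<Sigma> V" and pos: "0 < sigma_min \<Sigma>"
    and y: "y \<in> carrier_vec n" and sol: "lsq_solution X y \<beta>"
    and S: "S \<in> carrier_mat m n" and sol_S: "lsq_solution (S * X) (S *\<^sub>v y) \<beta>\<^sub>S"
    and weights: "\<forall>v\<in>carrier_vec n. \<forall>w\<in>carrier_vec n.
      (S *\<^sub>v v) \<bullet> (S *\<^sub>v w) = (\<Sum>i<n. wt i * (v $ i * w $ i))"
    and lower: "\<And>z. ip d z z \<le> 2 * (\<Sum>i<n. wt i * (ip d (u i) z)\<^sup>2)"
    and cross: "4 * ip d g g \<le> \<epsilon> * (\<Sum>i<n. (r $ i)\<^sup>2)"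
  shows "(l2_norm (y - X *\<^sub>v \<beta>\<^sub>S))\<^sup>2 \<le> (1 + \<epsilon>) * (l2_norm (y - X *\<^sub>v \<beta>))\<^sup>2"
    and "(l2_norm (\<beta> - \<beta>\<^sub>S))\<^sup>2 \<le> \<epsilon> / (sigma_min \<Sigma>)\<^sup>2 * (l2_norm (y - X *\<^sub>v \<beta>))\<^sup>2"
proof -
  have U: "U \<in> carrier_mat n d" and \<Sigma>: "\<Sigma> \<in> carrier_mat d d" and V: "V \<in> carrier_mat d d"
    and UU: "U\<^sup>T * U = 1\<^sub>m d" and VV: "V\<^sup>T * V = 1\<^sub>m d" and diag: "diagonal_mat \<Sigma>"
    using svd X by (auto simp: thin_svd_def)
  \<comment> \<open>As \<open>V\<close> is square, its transpose is an isometry too; this later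
    converts the bound on \<open>z\<close> into one on \<delta>.\<close>
  have VV': "V * V\<^sup>T = 1\<^sub>m d"
    using mat_mult_left_right_inverse[OF _ V VV] V by simp
  have \<beta>: "\<beta> \<in> carrier_vec d"
    using sol X by (simp add: lsq_solution_def is_arg_min_def)
  have \<beta>S: "\<beta>\<^sub>S \<in> carrier_vec d"
    using sol_S X by (simp add: lsq_solution_def is_arg_min_def)
  define \<delta> where "\<delta> = \<beta> - \<beta>\<^sub>S"
  have \<delta>: "\<delta> \<in> carrier_vec d"
    using \<beta> \<beta>S by (simp add: \<delta>_def)
  define z where "z = \<Sigma> *\<^sub>v (V\<^sup>T *\<^sub>v \<delta>)"
  have VT\<delta>: "V\<^sup>T *\<^sub>v \<delta> \<in> carrier_vec d"
    using V \<delta> by simp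
  have z: "z \<in> carrier_vec d"
    using \<Sigma> VT\<delta> by (simp add: z_def)
  have X\<delta>: "X *\<^sub>v \<delta> = U *\<^sub>v z"
    unfolding z_def by (rule thin_svd_mult_vec[OF X svd \<delta>])
  have X\<delta>_n: "X *\<^sub>v \<delta> \<in> carrier_vec n"
    using X \<delta> by simp
  have r: "r \<in> carrier_vec n"
    using y X \<beta> by (auto simp: r_def)
  have X\<delta>_i: "(X *\<^sub>v \<delta>) $ i = ip d (u i) (vec_index z)" if "i < n" for i
    using that U z by (simp add: X\<delta> ip_def u_def scalar_prod_def atLeast0LessThan)
  have orth: "(X *\<^sub>v \<delta>) \<bullet> r = 0"
    unfolding r_def by (rule lsq_solution_normal_eq[OF X y sol \<delta>])
  have res_S: "y - X *\<^sub>v \<beta>\<^sub>S = r + X *\<^sub>v \<delta>"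
    using y X \<beta> \<beta>S
    by (intro eq_vecI) (auto simp: r_def \<delta>_def mult_minus_distrib_mat_vec[OF X])
  have z_norm: "(X *\<^sub>v \<delta>) \<bullet> (X *\<^sub>v \<delta>) = z \<bullet> z"
    unfolding X\<delta> by (rule isometry_scalar_prod[OF U UU z z])
  define Z where "Z = z \<bullet> z"
  define R where "R = r \<bullet> r"
  have R_sum: "R = (\<Sum>i<n. (r $ i)\<^sup>2)"
    using r by (simp add: R_def scalar_prod_def atLeast0LessThan power2_eq_square)
  have Z_ip: "Z = ip d (vec_index z) (vec_index z)"
    unfolding Z_def by (rule scalar_prod_eq_ip[OF z])

  have "(S *\<^sub>v (X *\<^sub>v \<delta>)) \<bullet> (S *\<^sub>v (r + X *\<^sub>v \<delta>)) = 0"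
  proof -
    have "(S * X *\<^sub>v \<delta>) \<bullet> (S *\<^sub>v y - S * X *\<^sub>v \<beta>\<^sub>S) = 0"
      using S X y \<delta> by (intro lsq_solution_normal_eq[OF _ _ sol_S]) auto
    moreover have "S *\<^sub>v y - S * X *\<^sub>v \<beta>\<^sub>S = S *\<^sub>v (y - X *\<^sub>v \<beta>\<^sub>S)"
      using S X y \<beta>S by (simp add: mult_minus_distrib_mat_vec[OF S y])
    ultimately show ?thesis
      using S X \<delta> by (simp add: res_S)
  qed
  then have "(\<Sum>i<n. wt i * ((X *\<^sub>v \<delta>) $ i * (r + X *\<^sub>v \<delta>) $ i)) = 0"
    using weights[rule_format, OF X\<delta>_n, of "r + X *\<^sub>v \<delta>"] r X\<delta>_n by simp
  also have "(\<Sum>i<n. wt i * ((X *\<^sub>v \<delta>) $ i * (r + X *\<^sub>v \<delta>) $ i))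
      = (\<Sum>i<n. wt i * (ip d (u i) (vec_index z))\<^sup>2 + wt i * r $ i * ip d (u i) (vec_index z))"
  proof (intro sum.cong refl)
    fix i assume "i \<in> {..<n}"
    then have i: "i < n" by simp
    then have "(r + X *\<^sub>v \<delta>) $ i = r $ i + ip d (u i) (vec_index z)"
      using X\<delta>_i[OF i] X\<delta>_n by (metis carrier_vecD index_add_vec(1))
    then show "wt i * ((X *\<^sub>v \<delta>) $ i * (r + X *\<^sub>v \<delta>) $ i)
        = wt i * (ip d (u i) (vec_index z))\<^sup>2 + wt i * r $ i * ip d (u i) (vec_index z)"
      unfolding X\<delta>_i[OF i] by (simp add: power2_eq_square algebra_simps)
  qed
  finally have "(\<Sum>i<n. wt i * (ip d (u i) (vec_index z))\<^sup>2)
      = - (\<Sum>i<n. wt i * r $ i * ip d (u i) (vec_index z))"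
    by (simp add: sum.distrib)
  \<comment> \<open>Subtracting the exact normal equation replaces the weights \<open>wt i\<close>
    by the centred \<open>wt i - 1\<close> that define \<open>g\<close>.\<close>
  moreover have "(\<Sum>i<n. r $ i * ip d (u i) (vec_index z)) = 0"
  proof -
    have "(\<Sum>i<n. r $ i * ip d (u i) (vec_index z)) = (\<Sum>i<n. (X *\<^sub>v \<delta>) $ i * r $ i)"
      by (intro sum.cong) (auto simp: X\<delta>_i simp del: index_mult_mat_vec)
    also have "\<dots> = (X *\<^sub>v \<delta>) \<bullet> r"
      using r by (simp add: scalar_prod_def atLeast0LessThan del: index_mult_mat_vec)
    finally show ?thesis using orth by simp
  qed
  moreover have "ip d (vec_index z) g = (\<Sum>i<n. (wt i - 1) * r $ i * ip d (u i) (vec_index z))"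
    by (simp add: g_def ip_sum_right ip_commute[of d "vec_index z"])
  ultimately have "(\<Sum>i<n. wt i * (ip d (u i) (vec_index z))\<^sup>2) = - ip d (vec_index z) g"
    by (simp add: left_diff_distrib sum_subtractf)
  then have Z_le: "Z \<le> 2 * \<bar>ip d (vec_index z) g\<bar>"
    using lower[of "vec_index z"] by (simp add: Z_ip)
  have "0 \<le> Z" "0 \<le> R"
    by (simp_all add: Z_def R_def scalar_prod_self_nonneg)
  have "Z * Z \<le> (2 * \<bar>ip d (vec_index z) g\<bar>) * (2 * \<bar>ip d (vec_index z) g\<bar>)"
    using Z_le \<open>0 \<le> Z\<close> by (intro mult_mono) auto
  also have "\<dots> \<le> Z * (4 * ip d g g)"
    using ip_Cauchy_Schwarz[of d "vec_index z" g] by (simp add: Z_ip power2_eq_square)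
  also have "\<dots> \<le> Z * (\<epsilon> * R)"
    using cross \<open>0 \<le> Z\<close> by (intro mult_left_mono) (simp_all add: R_sum)
  finally have "Z * Z \<le> Z * (\<epsilon> * R)" .
  \<comment> \<open>The sign comes from \<open>cross\<close>; it settles the case
    \<open>Z = 0\<close>, where the inequality above cannot be divided by \<open>Z\<close>.\<close>
  moreover have "0 \<le> \<epsilon> * R"
    using cross ip_nonneg[of d g] by (simp add: R_sum)
  ultimately have Z_bound: "Z \<le> \<epsilon> * R"
    using \<open>0 \<le> Z\<close> by (cases "Z = 0") auto

  \<comment> \<open>Pythagoras: the optimal residual is orthogonal to the range of \<open>X\<close>,
    so the excess loss is exactly \<open>Z\<close>.\<close>
  have "(l2_norm (y - X *\<^sub>v \<beta>\<^sub>S))\<^sup>2 = R + Z"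
  proof -
    have "(r + X *\<^sub>v \<delta>) \<bullet> (r + X *\<^sub>v \<delta>) = r \<bullet> r + 2 * ((X *\<^sub>v \<delta>) \<bullet> r) + (X *\<^sub>v \<delta>) \<bullet> (X *\<^sub>v \<delta>)"
      using r X\<delta>_n by (simp add: scalar_prod_add_distrib[of _ n] add_scalar_prod_distrib[of _ n]
          comm_scalar_prod[of r n "X *\<^sub>v \<delta>"])
    then show ?thesis
      by (simp add: l2_norm_sq res_S orth z_norm R_def Z_def)
  qed
  then show "(l2_norm (y - X *\<^sub>v \<beta>\<^sub>S))\<^sup>2 \<le> (1 + \<epsilon>) * (l2_norm (y - X *\<^sub>v \<beta>))\<^sup>2"
    using Z_bound by (simp add: l2_norm_sq R_def r_def[symmetric] distrib_right)

  have "(sigma_min \<Sigma>)\<^sup>2 * (\<delta> \<bullet> \<delta>) \<le> Z"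
    using sigma_mult_vec_bounds(1)[OF \<Sigma> diag _ VT\<delta>] pos
      isometry_scalar_prod[of "V\<^sup>T" d d \<delta> \<delta>] V VV' \<delta>
    by (simp add: Z_def z_def)
  also note Z_bound
  finally show "(l2_norm (\<beta> - \<beta>\<^sub>S))\<^sup>2 \<le> \<epsilon> / (sigma_min \<Sigma>)\<^sup>2 * (l2_norm (y - X *\<^sub>v \<beta>))\<^sup>2"
    using pos by (simp add: l2_norm_sq r_def[symmetric] \<delta>_def[symmetric] R_def field_simps)
qed

text \<open>The fit \<open>h\<close> is the projection of \<open>y\<close> onto the range of
  \<open>U\<close>, so \<gamma> bounds the residual by Pythagoras in terms of \<open>h\<close>,
  whose norm is at most \<open>sigma_max\<close> times that of \<beta>. No sampling is
  involved.\<close>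

lemma residual_bound:
  assumes X: "X \<in> carrier_mat n d" and svd: "thin_svd X U \<Sigma> V" and pos: "0 < sigma_min \<Sigma>"
    and y: "y \<in> carrier_vec n" and sol: "lsq_solution X y \<beta>"
    and "0 \<le> \<epsilon>" and "0 < \<gamma>" and \<gamma>_le: "\<gamma> \<le> l2_norm (U * U\<^sup>T *\<^sub>v y) / l2_norm y"
  shows "\<epsilon> / (sigma_min \<Sigma>)\<^sup>2 * (l2_norm (y - X *\<^sub>v \<beta>))\<^sup>2
    \<le> \<epsilon> * (cond_number \<Sigma>)\<^sup>2 * (1 / \<gamma>\<^sup>2 - 1) * (l2_norm \<beta>)\<^sup>2"
proof -
  have U: "U \<in> carrier_mat n d" and \<Sigma>: "\<Sigma> \<in> carrier_mat d d" and V: "V \<in> carrier_mat d d"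
    and UU: "U\<^sup>T * U = 1\<^sub>m d" and VV: "V\<^sup>T * V = 1\<^sub>m d" and diag: "diagonal_mat \<Sigma>"
    using svd X by (auto simp: thin_svd_def)
  have VV': "V * V\<^sup>T = 1\<^sub>m d"
    using mat_mult_left_right_inverse[OF _ V VV] V by simp
  have \<beta>: "\<beta> \<in> carrier_vec d"
    using sol X by (simp add: lsq_solution_def is_arg_min_def)
  note XU = thin_svd_mult_vec[OF X svd]
  define r where "r = y - X *\<^sub>v \<beta>"
  define h where "h = X *\<^sub>v \<beta>"
  have h: "h \<in> carrier_vec n"
    using X \<beta> by (simp add: h_def)
  have r: "r \<in> carrier_vec n"
    using y X \<beta> by (auto simp: r_def)
  have y_eq: "y = h + r"
    using y X \<beta> by (intro eq_vecI) (auto simp: r_def h_def)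
  have rh: "h \<bullet> r = 0"
    unfolding r_def h_def by (rule lsq_solution_normal_eq[OF X y sol \<beta>])
  \<comment> \<open>Testing the normal equations against the right singular vectors gives each
    coordinate times its singular value, which is positive.\<close>
  have UTr: "U\<^sup>T *\<^sub>v r = 0\<^sub>v d"
  proof (rule eq_vecI)
    fix k assume "k < dim_vec (0\<^sub>v d :: real vec)"
    then have k: "k < d" by simp
    define \<delta> where "\<delta> = V *\<^sub>v unit_vec d k"
    have \<delta>: "\<delta> \<in> carrier_vec d"
      using V by (simp add: \<delta>_def)
    have "V\<^sup>T *\<^sub>v \<delta> = unit_vec d k"
      using assoc_mult_mat_vec[of "V\<^sup>T" d d V d "unit_vec d k"] V VV by (simp add: \<delta>_def)
    moreover have "\<Sigma> *\<^sub>v unit_vec d k = \<Sigma> $$ (k, k) \<cdot>\<^sub>v unit_vec d k"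
      using mult_diagonal_mat_vec[OF \<Sigma> diag] \<Sigma> k
      by (intro eq_vecI) (auto simp del: index_mult_mat_vec)
    ultimately have "X *\<^sub>v \<delta> = \<Sigma> $$ (k, k) \<cdot>\<^sub>v (U *\<^sub>v unit_vec d k)"
      using XU[OF \<delta>] mult_mat_vec[OF U, of "unit_vec d k"] by simp
    moreover have "(X *\<^sub>v \<delta>) \<bullet> r = 0"
      unfolding r_def by (rule lsq_solution_normal_eq[OF X y sol \<delta>])
    ultimately have "\<Sigma> $$ (k, k) * ((U *\<^sub>v unit_vec d k) \<bullet> r) = 0"
      using U r by (simp add: smult_scalar_prod_distrib[of _ n])
    then have "(U *\<^sub>v unit_vec d k) \<bullet> r = 0"
      using sigma_bounds(1)[OF \<Sigma> k] pos by simp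
    then have "(U\<^sup>T *\<^sub>v r) \<bullet> unit_vec d k = 0"
      using transpose_vec_mult_scalar[OF U, of "unit_vec d k" r] U r
      by (simp add: comm_scalar_prod[of r n])
    then show "(U\<^sup>T *\<^sub>v r) $ k = 0\<^sub>v d $ k"
      using U k r by (simp add: scalar_prod_right_unit)
  qed (use U in simp)
  define g where "g = \<Sigma> *\<^sub>v (V\<^sup>T *\<^sub>v \<beta>)"
  have g: "g \<in> carrier_vec d"
    using \<Sigma> V \<beta> by (simp add: g_def)
  have h_g: "h = U *\<^sub>v g"
    using XU[OF \<beta>] by (simp add: h_def g_def)
  have "U\<^sup>T *\<^sub>v h = g"
    using assoc_mult_mat_vec[of "U\<^sup>T" d n U d g] U UU g by (simp add: h_g)
  then have "U\<^sup>T *\<^sub>v y = g"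
    using mult_add_distrib_mat_vec[of "U\<^sup>T" d n h r] U h r g by (simp add: y_eq UTr)
  then have proj: "U * U\<^sup>T *\<^sub>v y = h"
    using assoc_mult_mat_vec[of U n d "U\<^sup>T" n y] U y by (simp add: h_g)
  have norm_y: "y \<bullet> y = h \<bullet> h + r \<bullet> r"
    using h r rh by (simp add: y_eq scalar_prod_add_distrib[of _ n] add_scalar_prod_distrib[of _ n]
        comm_scalar_prod[of r n h])
  \<comment> \<open>For zero norm the quotient in \<open>\<gamma>_le\<close> would be 0, against
    positivity of \<gamma>.\<close>
  have "l2_norm y \<noteq> 0"
    using \<gamma>_le \<open>0 < \<gamma>\<close> by auto
  then have "0 < l2_norm y"
    using scalar_prod_self_nonneg[of y] by (simp add: l2_norm_def)
  then have "\<gamma> * l2_norm y \<le> l2_norm h"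
    using \<gamma>_le by (simp add: proj pos_le_divide_eq)
  then have "(\<gamma> * l2_norm y)\<^sup>2 \<le> (l2_norm h)\<^sup>2"
    using \<open>0 < \<gamma>\<close> \<open>0 < l2_norm y\<close> by (intro power_mono) auto
  then have "\<gamma>\<^sup>2 * (h \<bullet> h + r \<bullet> r) \<le> h \<bullet> h"
    by (simp add: power_mult_distrib l2_norm_sq norm_y)
  then have r_le: "r \<bullet> r \<le> (1 / \<gamma>\<^sup>2 - 1) * (h \<bullet> h)"
    using \<open>0 < \<gamma>\<close> by (simp add: field_simps)
  have h_le: "h \<bullet> h \<le> (sigma_max \<Sigma>)\<^sup>2 * (\<beta> \<bullet> \<beta>)"
    using sigma_mult_vec_bounds(2)[OF \<Sigma> diag, of "V\<^sup>T *\<^sub>v \<beta>"] pos V \<beta>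
      isometry_scalar_prod[OF U UU g g] isometry_scalar_prod[of "V\<^sup>T" d d \<beta> \<beta>] VV'
    by (simp add: h_g g_def)
  \<comment> \<open>The sign is needed to multiply \<open>h_le\<close> by this factor. Since
    \<open>h\<close> is nonzero, a negative factor would make the squared norm of \<open>r\<close>
    negative.\<close>
  have "0 \<le> 1 / \<gamma>\<^sup>2 - 1"
  proof (rule ccontr)
    assume neg: "\<not> ?thesis"
    have "0 < h \<bullet> h"
    proof -
      have "0 < l2_norm h"
        using \<open>\<gamma> * l2_norm y \<le> l2_norm h\<close> mult_pos_pos[OF \<open>0 < \<gamma>\<close> \<open>0 < l2_norm y\<close>]
        by linarith
      then show ?thesis
        by (simp add: l2_norm_def)
    qed
    then have "(1 / \<gamma>\<^sup>2 - 1) * (h \<bullet> h) < 0"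
      using neg by (intro mult_neg_pos) auto
    then show False
      using r_le scalar_prod_self_nonneg[of r] by linarith
  qed
  then have "r \<bullet> r \<le> (1 / \<gamma>\<^sup>2 - 1) * ((sigma_max \<Sigma>)\<^sup>2 * (\<beta> \<bullet> \<beta>))"
    using r_le h_le by (meson mult_left_mono order_trans)
  then have "\<epsilon> / (sigma_min \<Sigma>)\<^sup>2 * (r \<bullet> r)
      \<le> \<epsilon> / (sigma_min \<Sigma>)\<^sup>2 * ((1 / \<gamma>\<^sup>2 - 1) * ((sigma_max \<Sigma>)\<^sup>2 * (\<beta> \<bullet> \<beta>)))"
    using \<open>0 \<le> \<epsilon>\<close> by (intro mult_left_mono) auto
  then show ?thesis
    by (simp add: l2_norm_sq cond_number_def power_divide mult_ac flip: r_def)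
qed

section \<open>Choice of constants and the success probability\<close>

text \<open>The base is below \<open>exp (- 1)\<close>, so a power of order \<open>ln d\<close>
  beats the factor \<open>d\<close>; the extra 4 in \<open>P\<close> leaves
  \<open>exp (- 4)\<close>, at most \<open>1 / 16\<close>.\<close>

lemma sample_size_bounds:
  fixes d c :: nat
  assumes "0 < d" and c: "2000 * (real d * ln (real d)) \<le> c" and c0: "2000 \<le> c"
  defines "P \<equiv> nat \<lceil>ln (real d)\<rceil> + 4"
  shows "2 * real P * (d / c) \<le> 1" and "(40 * real P * (d / c)) ^ P * d \<le> 1 / 10"
proof -
  have ln_nonneg: "0 \<le> ln (real d)"
    using assms(1) by simp
  have P_le: "real P \<le> ln (real d) + 5" and P_ge: "ln (real d) + 4 \<le> real P"
    using ln_nonneg unfolding P_def by linarith+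
  \<comment> \<open>For \<open>d = 1\<close> the logarithm vanishes and \<open>c0\<close> with
    \<open>P \<le> 5\<close> suffices. Otherwise \<open>ln d\<close> is at least
    \<open>1 / 2\<close>, so the additive 5 is at most \<open>10 * ln d\<close>, giving 11 in
    total.\<close>
  have Pd: "2000 * (P * d) \<le> 11 * real c"
  proof (cases "d = 1")
    case True
    then show ?thesis
      using P_le c0 by simp
  next
    case False
    then have "2 \<le> real d"
      using assms(1) by linarith
    then have "ln 2 \<le> ln (real d)"
      by simp
    then have "1 / 2 \<le> ln (real d)"
      using ln2_ge_two_thirds by linarith
    then have "real P \<le> 11 * ln (real d)"
      using P_le by linarith
    then have "real P * d \<le> 11 * ln (real d) * d"
      by (intro mult_right_mono) auto
    then show ?thesis
      using c by (simp add: mult_ac)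
  qed
  define x where "x = real P * (d / c)"
  have x: "0 \<le> x" "x \<le> 11 / 2000"
    using Pd c0 by (simp_all add: x_def field_simps)
  then show "2 * real P * (d / c) \<le> 1"
    unfolding mult.assoc x_def[symmetric] by linarith
  have "40 * x \<le> 1 / 3"
    using x by linarith
  also have "\<dots> \<le> exp (- 1)"
    using exp_le by (simp add: exp_minus field_simps)
  finally have "(40 * x) ^ P \<le> exp (- 1) ^ P"
    using x by (intro power_mono) auto
  also have "\<dots> = exp (- real P)"
    by (simp flip: exp_of_nat_mult)
  also have "\<dots> \<le> exp (- ln (real d) - 4)"
    using P_ge by simp
  also have "\<dots> = exp (- 1) ^ 4 / d"
    using assms(1) by (simp add: exp_diff exp_minus field_simps flip: exp_of_nat_mult)
  finally have "(40 * x) ^ P * d \<le> exp (- 1) ^ 4"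
    using assms(1) by (simp add: field_simps)
  also have "\<dots> \<le> (1 / 2) ^ 4"
    using exp_ge_add_one_self[of 1] by (intro power_mono) (simp_all add: exp_minus field_simps)
  also have "\<dots> \<le> 1 / 10"
    by (simp add: power4_eq_xxxx)
  finally show "(40 * real P * (d / c)) ^ P * d \<le> 1 / 10"
    by (simp only: x_def mult.assoc)
qed

lemma bernoulli_sampling_leverage:
  assumes U: "U \<in> carrier_mat n d" and UU: "U\<^sup>T * U = 1\<^sub>m d" and "0 < d" and "0 < c"
  shows "bernoulli_sampling n d (\<lambda>i k. U $$ (i, k)) (sampling_prob U c) (d / c)"
proof
  have lev: "leverage_score U i = ip d (\<lambda>k. U $$ (i, k)) (\<lambda>k. U $$ (i, k))" if "i < n" for i
    using U that by (simp add: leverage_score_def l2_norm_sq scalar_prod_def ip_def atLeast0LessThan)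
  fix i assume i: "i < n"
  show "0 \<le> sampling_prob U c i" "sampling_prob U c i \<le> 1"
    by (simp_all add: sampling_prob_def leverage_score_def)
  show "sampling_prob U c i = 1
      \<or> ip d (\<lambda>k. U $$ (i, k)) (\<lambda>k. U $$ (i, k)) \<le> real d / real c * sampling_prob U c i"
    using assms U by (auto simp: sampling_prob_def lev[OF i] min_def)
next
  show "0 \<le> real d / real c" by simp
  show "(\<Sum>i<n. ip d (\<lambda>k. U $$ (i, k)) x * ip d (\<lambda>k. U $$ (i, k)) y) = ip d x y" for x y
    by (rule sum_ip_rows[OF U UU])
qed

text \<open>The two bad events, a lost direction and a large cross term, have probability at most
  \<open>1 / 10\<close> each; outside both, \<open>sketched_solution_bound\<close> applies to every
  sketched minimizer.\<close>

lemma leverage_sampling_regression: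
  assumes X: "X \<in> carrier_mat n d" and "0 < d" and svd: "thin_svd X U \<Sigma> V"
    and pos: "0 < sigma_min \<Sigma>" and y: "y \<in> carrier_vec n" and "0 < \<epsilon>"
    and sol: "lsq_solution X y \<beta>"
    and c: "2000 * (real d * ln (real d) + real d / \<epsilon>) \<le> real c" and c0: "2000 \<le> real c"
  shows "0.8 \<le> measure_pmf.prob (sampled_indices U c)
    {C. \<forall>\<beta>\<^sub>S. lsq_solution (sampling_mat U c C * X) (sampling_mat U c C *\<^sub>v y) \<beta>\<^sub>S \<longrightarrow>
      (l2_norm (y - X *\<^sub>v \<beta>\<^sub>S))\<^sup>2 \<le> (1 + \<epsilon>) * (l2_norm (y - X *\<^sub>v \<beta>))\<^sup>2 \<and>
      (l2_norm (\<beta> - \<beta>\<^sub>S))\<^sup>2 \<le> \<epsilon> / (sigma_min \<Sigma>)\<^sup>2 * (l2_norm (y - X *\<^sub>v \<beta>))\<^sup>2}"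
    (is "_ \<le> measure_pmf.prob _ {C. ?good C}")
proof -
  have U: "U \<in> carrier_mat n d" and UU: "U\<^sup>T * U = 1\<^sub>m d"
    using svd X by (auto simp: thin_svd_def)
  define u where "u = (\<lambda>i k. U $$ (i, k))"
  define r where "r = y - X *\<^sub>v \<beta>"
  have "0 < c"
    using c0 by (cases c) auto
  interpret bernoulli_sampling n d u "sampling_prob U c" "d / c"
    unfolding u_def by (rule bernoulli_sampling_leverage) (use U UU \<open>0 < d\<close> \<open>0 < c\<close> in auto)
  define bad1 where "bad1 = {\<xi>. \<exists>z. 2 * (\<Sum>i<n. weight \<xi> i * (ip d (u i) z)\<^sup>2) < ip d z z}"
  define bad2 where "bad2 = {\<xi>. \<epsilon> * (\<Sum>i<n. (r $ i)\<^sup>2)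
    < 4 * ip d (cross_dev (vec_index r) \<xi>) (cross_dev (vec_index r) \<xi>)}"
  have c1: "2000 * (real d * ln (real d)) \<le> c" and c2: "2000 * (real d / \<epsilon>) \<le> c"
    using c \<open>0 < d\<close> \<open>0 < \<epsilon>\<close> by (auto simp: distrib_left intro: order_trans[rotated])
  define P where "P = nat \<lceil>ln (real d)\<rceil> + 4"
  have P: "2 * real P * (d / c) \<le> 1" "(40 * real P * (d / c)) ^ P * d \<le> 1 / 10"
    unfolding P_def using sample_size_bounds[OF \<open>0 < d\<close> c1] c0 by auto
  have "measure_pmf.prob sample bad1 \<le> (40 * real P * (d / c)) ^ P * (\<Sum>i<n. ip d (u i) (u i))"
    unfolding bad1_def by (rule prob_gram_lower_tail[OF P(1)])
  also have "(\<Sum>i<n. ip d (u i) (u i)) = d"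
    unfolding u_def by (rule sum_ip_rows_self[OF U UU])
  also note P(2)
  finally have prob1: "measure_pmf.prob sample bad1 \<le> 1 / 10" .
  have "measure_pmf.prob sample bad2 \<le> 4 * (d / c) / \<epsilon>"
    unfolding bad2_def by (rule prob_cross_dev[OF \<open>0 < \<epsilon>\<close>])
  also have "\<dots> \<le> 1 / 10"
    using c2 \<open>0 < c\<close> \<open>0 < \<epsilon>\<close> by (simp add: field_simps)
  finally have prob2: "measure_pmf.prob sample bad2 \<le> 1 / 10" .
  have good: "?good {i. i < dim_row U \<and> \<xi> i}" if "\<xi> \<notin> bad1" "\<xi> \<notin> bad2" for \<xi>
  proof (intro allI impI)
    define C where "C = {i. i < dim_row U \<and> \<xi> i}"
    have C: "C \<subseteq> {..<n}" and dimU: "dim_row U = n"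
      using U by (auto simp: C_def)
    fix \<beta>\<^sub>S assume sol_S: "lsq_solution (sampling_mat U c {i. i < dim_row U \<and> \<xi> i} * X)
      (sampling_mat U c {i. i < dim_row U \<and> \<xi> i} *\<^sub>v y) \<beta>\<^sub>S"
    have "(\<Sum>i<n. of_bool (i \<in> C) / sampling_prob U c i * (v $ i * w $ i))
        = (\<Sum>i<n. weight \<xi> i * (v $ i * w $ i))" for v w :: "real vec"
      by (intro sum.cong) (auto simp: weight_def C_def dimU)
    then have weights: "\<forall>v\<in>carrier_vec n. \<forall>w\<in>carrier_vec n.
        (sampling_mat U c C *\<^sub>v v) \<bullet> (sampling_mat U c C *\<^sub>v w)
          = (\<Sum>i<n. weight \<xi> i * (v $ i * w $ i))"
      by (simp add: sampling_mat_scalar_prod[OF dimU C])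
    have lower: "ip d z z \<le> 2 * (\<Sum>i<n. weight \<xi> i * (ip d (u i) z)\<^sup>2)" for z
      using \<open>\<xi> \<notin> bad1\<close> by (auto simp: bad1_def not_less)
    have cross: "4 * ip d (cross_dev (vec_index r) \<xi>) (cross_dev (vec_index r) \<xi>)
        \<le> \<epsilon> * (\<Sum>i<n. (r $ i)\<^sup>2)"
      using \<open>\<xi> \<notin> bad2\<close> by (simp add: bad2_def not_less)
    note bound = sketched_solution_bound[OF X svd pos y sol sampling_mat_carrier[OF dimU C]
        sol_S[folded C_def] weights lower[unfolded u_def] cross[unfolded cross_dev_def, unfolded u_def r_def]]
    show "(l2_norm (y - X *\<^sub>v \<beta>\<^sub>S))\<^sup>2 \<le> (1 + \<epsilon>) * (l2_norm (y - X *\<^sub>v \<beta>))\<^sup>2 \<and>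
      (l2_norm (\<beta> - \<beta>\<^sub>S))\<^sup>2 \<le> \<epsilon> / (sigma_min \<Sigma>)\<^sup>2 * (l2_norm (y - X *\<^sub>v \<beta>))\<^sup>2"
      by (rule conjI) (rule bound)+
  qed
  have "1 - measure_pmf.prob sample (bad1 \<union> bad2) \<ge> 0.8"
    using measure_Un_le[of bad1 "measure_pmf sample" bad2] prob1 prob2 by simp
  also have "1 - measure_pmf.prob sample (bad1 \<union> bad2) = measure_pmf.prob sample (- (bad1 \<union> bad2))"
    using measure_pmf.prob_compl[of "bad1 \<union> bad2" sample] by (simp add: Compl_eq_Diff_UNIV)
  also have "\<dots> \<le> measure_pmf.prob sample {\<xi>. ?good {i. i < dim_row U \<and> \<xi> i}}"
    using good by (intro measure_pmf.finite_measure_mono) auto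
  also have "\<dots> = measure_pmf.prob (sampled_indices U c) {C. ?good C}"
    using U by (simp add: sampled_indices_def sample_def vimage_def)
  finally show ?thesis .
qed

text \<open>The separate bound \<open>real c \<ge> K\<close> matters for \<open>d = 1\<close> and
  large \<epsilon>, where the other lower bound on \<open>c\<close> becomes small. The last
  inequality holds for every sample, so only the first two consume probability.\<close>

theorem theorem1:
  shows "\<exists>K::real. K > 0 \<and>
    (\<forall>(n::nat) (d::nat) (c::nat) (X::real mat) (U::real mat) (\<Sigma>::real mat) (V::real mat)
       (y::real vec) (\<epsilon>::real) (\<beta>_lsr::real vec).
      X \<in> carrier_mat n d \<longrightarrow> 0 < d \<longrightarrow> d < n \<longrightarrow>
      thin_svd X U \<Sigma> V \<longrightarrow> 0 < sigma_min \<Sigma> \<longrightarrow>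
      y \<in> carrier_vec n \<longrightarrow> 0 < \<epsilon> \<longrightarrow>
      lsq_solution X y \<beta>_lsr \<longrightarrow>
      c < n \<longrightarrow>
      real c \<ge> K * (real d * ln (real d) + real d / \<epsilon>) \<longrightarrow> real c \<ge> K \<longrightarrow>
      measure_pmf.prob (sampled_indices U c)
        {C. \<forall>\<beta>_S. lsq_solution (sampling_mat U c C * X) (sampling_mat U c C *\<^sub>v y) \<beta>_S \<longrightarrow>
          (l2_norm (y - X *\<^sub>v \<beta>_S))\<^sup>2 \<le> (1 + \<epsilon>) * (l2_norm (y - X *\<^sub>v \<beta>_lsr))\<^sup>2 \<and>
          (l2_norm (\<beta>_lsr - \<beta>_S))\<^sup>2
            \<le> \<epsilon> / (sigma_min \<Sigma>)\<^sup>2 * (l2_norm (y - X *\<^sub>v \<beta>_lsr))\<^sup>2 \<and>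
          (\<forall>\<gamma>::real. 0 < \<gamma> \<longrightarrow>
             \<gamma> \<le> l2_norm (U * U\<^sup>T *\<^sub>v y) / l2_norm y \<longrightarrow>
             l2_norm (U * U\<^sup>T *\<^sub>v y) / l2_norm y \<le> 1 \<longrightarrow>
             \<epsilon> / (sigma_min \<Sigma>)\<^sup>2 * (l2_norm (y - X *\<^sub>v \<beta>_lsr))\<^sup>2
               \<le> \<epsilon> * (cond_number \<Sigma>)\<^sup>2 * (1 / \<gamma>\<^sup>2 - 1) * (l2_norm \<beta>_lsr)\<^sup>2)}
      \<ge> 0.8)"
proof (intro exI[of _ 2000] conjI allI impI)
  fix n d c :: nat and X U \<Sigma> V :: "real mat" and y \<beta>_lsr :: "real vec" and \<epsilon> :: real
  assume X: "X \<in> carrier_mat n d" and d: "0 < d" and svd: "thin_svd X U \<Sigma> V"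
    and pos: "0 < sigma_min \<Sigma>" and y: "y \<in> carrier_vec n" and \<epsilon>: "0 < \<epsilon>"
    and sol: "lsq_solution X y \<beta>_lsr"
    and c: "2000 * (real d * ln (real d) + real d / \<epsilon>) \<le> real c" "2000 \<le> real c"
  note residual = residual_bound[OF X svd pos y sol less_imp_le[OF \<epsilon>]]
  show "0.8 \<le> measure_pmf.prob (sampled_indices U c)
        {C. \<forall>\<beta>_S. lsq_solution (sampling_mat U c C * X) (sampling_mat U c C *\<^sub>v y) \<beta>_S \<longrightarrow>
          (l2_norm (y - X *\<^sub>v \<beta>_S))\<^sup>2 \<le> (1 + \<epsilon>) * (l2_norm (y - X *\<^sub>v \<beta>_lsr))\<^sup>2 \<and>
          (l2_norm (\<beta>_lsr - \<beta>_S))\<^sup>2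
            \<le> \<epsilon> / (sigma_min \<Sigma>)\<^sup>2 * (l2_norm (y - X *\<^sub>v \<beta>_lsr))\<^sup>2 \<and>
          (\<forall>\<gamma>::real. 0 < \<gamma> \<longrightarrow>
             \<gamma> \<le> l2_norm (U * U\<^sup>T *\<^sub>v y) / l2_norm y \<longrightarrow>
             l2_norm (U * U\<^sup>T *\<^sub>v y) / l2_norm y \<le> 1 \<longrightarrow>
             \<epsilon> / (sigma_min \<Sigma>)\<^sup>2 * (l2_norm (y - X *\<^sub>v \<beta>_lsr))\<^sup>2
               \<le> \<epsilon> * (cond_number \<Sigma>)\<^sup>2 * (1 / \<gamma>\<^sup>2 - 1) * (l2_norm \<beta>_lsr)\<^sup>2)}"
    by (rule order_trans[OF leverage_sampling_regression[OF X d svd pos y \<epsilon> sol c]],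
        rule measure_pmf.finite_measure_mono) (use residual in blast, simp)
qed simp

end
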